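(* Let $n\geq 1$ and let $\mathcal{T}_n=\mathrm{span}_{\mathbb{Q}}\{X_T:\ T\text{ an }n\text{-vertex tree}\}$. Then $$\mathcal{T}_n=\left\{\sum_{\lambda\vdash n}a_\lambda\,\mathfrak{st}_\lambda:\ a_\lambda\in\mathbb{Q},\ \sum_{\lambda\vdash n,\ \ell(\lambda)=\ell}a_\lambda=0\text{ for every }2\leq\ell\leq n\right\}.$$ Moreover, the set $$B=\{X_{\mathrm{Cat}_{\lambda_2\lambda_3\cdots\lambda_\ell\lambda_1}}:\ \lambda=\lambda_1\lambda_2\cdots\lambda_\ell\vdash n,\ \text{either }\lambda=n\text{ or }\lambda_2\geq 2\}$$ is a basis for $\mathcal{T}_n$.
   Context: For a finite simple graph $G=(V,E)$, a proper colouring is a function $\kappa:V\to\{1,2,3,\ldots\}$ with $\kappa(u)\neq\kappa(v)$ whenever $\{u,v\}\in E$. The chromatic symmetric function of $G$ is $X_G=\sum_{\kappa\text{ proper}}\prod_{v\in V}x_{\kappa(v)}$, a symmetric function in commuting variables $x_1,x_2,\ldots$, homogeneous of degree $|V|$. The star $\mathrm{St}_k$ is the $k$-vertex tree in which $k-1$ leaves are joined to a single central vertex ($\mathrm{St}_1$ is a single vertex). For a partition $\lambda=(\lambda_1\geq\cdots\geq\lambda_\ell)$ of $n$, its length is $\ell(\lambda)=\ell$, the graph $\mathrm{St}_\lambda$ is the disjoint union of $\mathrm{St}_{\lambda_1},\ldots,\mathrm{St}_{\lambda_\ell}$, and $\mathfrak{st}_\lambda=X_{\mathrm{St}_\lambda}$.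 It is known that $\{\mathfrak{st}_\lambda:\lambda\vdash n\}$ is a basis (over $\mathbb{Q}$) of the space of symmetric functions of degree $n$. For a composition $\alpha=\alpha_1\cdots\alpha_\ell$ of $n$ with $\alpha_1,\alpha_\ell\geq 2$, the caterpillar $\mathrm{Cat}_\alpha$ is the $n$-vertex tree formed by taking a path of $\ell$ vertices $v_1,\ldots,v_\ell$ and attaching $\alpha_i-1$ leaves to $v_i$ for each $1\leq i\leq\ell$. When $\lambda=n$ has a single part, the associated caterpillar is $\mathrm{Cat}_n=\mathrm{St}_n$ (a single vertex if $n=1$). The indexing composition $\lambda_2\lambda_3\cdots\lambda_\ell\lambda_1$ is the partition with its largest part moved to the end. *)

theory Defs
  imports Complex_Main "HOL-Library.FuncSet" "HOL-Library.Function_Algebras" "HOL-Library.Poly_Mapping"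
begin

text \<open>A graph is a pair of a vertex set and a set of edges, each edge being a set of two vertices.\<close>

type_synonym 'a graph = "'a set \<times> 'a set set"

abbreviation verts :: "'a graph \<Rightarrow> 'a set" where "verts G \<equiv> fst G"
abbreviation edges :: "'a graph \<Rightarrow> 'a set set" where "edges G \<equiv> snd G"

definition simple_graph :: "'a graph \<Rightarrow> bool" where
  "simple_graph G \<longleftrightarrow> finite (verts G) \<and> (\<forall>e\<in>edges G. e \<subseteq> verts G \<and> card e = 2)"

definition connected_graph :: "'a graph \<Rightarrow> bool" where
  "connected_graph G \<longleftrightarrow> verts G \<noteq> {} \<and>
    (\<forall>u\<in>verts G. \<forall>v\<in>verts G. (u, v) \<in> {(x, y). {x, y} \<in> edges G}\<^sup>*)"

definition cycle_in :: "'a graph \<Rightarrow> 'a list \<Rightarrow> bool" where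
  "cycle_in G c \<longleftrightarrow> length c \<ge> 3 \<and> distinct c \<and>
    (\<forall>i<length c. {c ! i, c ! (Suc i mod length c)} \<in> edges G)"

definition tree_graph :: "'a graph \<Rightarrow> bool" where
  "tree_graph G \<longleftrightarrow> simple_graph G \<and> connected_graph G \<and> (\<nexists>c. cycle_in G c)"

text \<open>The centre of the star is the vertex \<open>0\<close>.\<close>

definition star :: "nat \<Rightarrow> nat graph" where
  "star k = ({..<k}, {{0, j} | j. 1 \<le> j \<and> j < k})"

definition disjoint_union :: "'a graph list \<Rightarrow> (nat \<times> 'a) graph" where
  "disjoint_union Gs =
    ({(i, v). i < length Gs \<and> v \<in> verts (Gs ! i)},
     {Pair i ` e | i e. i < length Gs \<and> e \<in> edges (Gs ! i)})"

definition star_forest :: "nat list \<Rightarrow> (nat \<times> nat) graph" where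
  "star_forest p = disjoint_union (map star p)"

text \<open>The spine vertices are \<open>(i, 0)\<close>, and the leaves attached to \<open>(i, 0)\<close> are the \<open>(i, j)\<close>
  with \<open>1 \<le> j < \<alpha> ! i\<close>. For \<open>\<alpha> = [n]\<close> this is the star on \<open>n\<close> vertices.\<close>

definition caterpillar :: "nat list \<Rightarrow> (nat \<times> nat) graph" where
  "caterpillar \<alpha> =
    ({(i, j). i < length \<alpha> \<and> j < \<alpha> ! i},
     {{(i, 0), (Suc i, 0)} | i. Suc i < length \<alpha>} \<union>
     {{(i, 0), (i, j)} | i j. i < length \<alpha> \<and> 1 \<le> j \<and> j < \<alpha> ! i})"

text \<open>A formal power series over the rationals in the variables \<open>x\<^sub>1, x\<^sub>2, \<dots>\<close> is given by its
  coefficients; the monomial with exponent vector \<open>m\<close> is the product of the \<open>x\<^sub>i\<close> to the power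
  \<open>Poly_Mapping.lookup m i\<close>. Addition is pointwise; the pointwise product on functions provided by the
  imported theory is not the product of power series and is not used.\<close>

type_synonym power_series = "(nat \<Rightarrow>\<^sub>0 nat) \<Rightarrow> rat"

definition ps_scale :: "rat \<Rightarrow> power_series \<Rightarrow> power_series" where
  "ps_scale c F = (\<lambda>m. c * F m)"

global_interpretation ps: vector_space ps_scale
  by standard (auto simp: ps_scale_def algebra_simps fun_eq_iff)

definition proper_colourings :: "'a graph \<Rightarrow> ('a \<Rightarrow> nat) set" where
  "proper_colourings G =
    {\<kappa> \<in> verts G \<rightarrow>\<^sub>E {1..}. \<forall>u v. {u, v} \<in> edges G \<longrightarrow> \<kappa> u \<noteq> \<kappa> v}"

text \<open>Exponent vector of the monomial that is the product, over all vertices \<open>v\<close>, of the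
  variable with index \<open>\<kappa> v\<close>.\<close>

definition colour_monom :: "'a graph \<Rightarrow> ('a \<Rightarrow> nat) \<Rightarrow> (nat \<Rightarrow>\<^sub>0 nat)" where
  "colour_monom G \<kappa> = (\<Sum>v\<in>verts G. Poly_Mapping.single (\<kappa> v) 1)"

text \<open>In the infinite sum of monomials over all proper colourings, the coefficient of a given
  monomial is the number of proper colourings yielding it.\<close>

definition chromatic_sym :: "'a graph \<Rightarrow> power_series" where
  "chromatic_sym G = (\<lambda>m. of_nat (card {\<kappa> \<in> proper_colourings G. colour_monom G \<kappa> = m}))"

lemma finite_colourings_of_monom:
  assumes "finite (verts G)"
  shows "finite {\<kappa> \<in> proper_colourings G. colour_monom G \<kappa> = m}"
proof (rule finite_subset)
  show "finite (verts G \<rightarrow>\<^sub>E Poly_Mapping.keys m)"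
    using assms by (intro finite_PiE) auto
  show "{\<kappa> \<in> proper_colourings G. colour_monom G \<kappa> = m} \<subseteq> verts G \<rightarrow>\<^sub>E Poly_Mapping.keys m"
  proof
    fix \<kappa> assume \<kappa>: "\<kappa> \<in> {\<kappa> \<in> proper_colourings G. colour_monom G \<kappa> = m}"
    have "\<kappa> v \<in> Poly_Mapping.keys m" if v: "v \<in> verts G" for v
    proof -
      have "Poly_Mapping.lookup (colour_monom G \<kappa>) (\<kappa> v)
          = (\<Sum>u\<in>verts G. Poly_Mapping.lookup (Poly_Mapping.single (\<kappa> u) (1::nat)) (\<kappa> v))"
        by (simp add: colour_monom_def lookup_sum)
      also have "\<dots> \<ge> Poly_Mapping.lookup (Poly_Mapping.single (\<kappa> v) (1::nat)) (\<kappa> v)"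
        using assms v by (intro member_le_sum) auto
      finally show ?thesis using \<kappa> by (auto simp: in_keys_iff)
    qed
    with \<kappa> show "\<kappa> \<in> verts G \<rightarrow>\<^sub>E Poly_Mapping.keys m"
      by (auto simp: proper_colourings_def PiE_def)
  qed
qed

text \<open>A partition of \<open>n\<close> is the weakly decreasing list of its (positive) parts.\<close>

definition partitions :: "nat \<Rightarrow> nat list set" where
  "partitions n = {p. sorted_wrt (\<ge>) p \<and> (\<forall>k\<in>set p. k \<ge> 1) \<and> sum_list p = n}"

lemma finite_partitions: "finite (partitions n)"
proof (rule finite_subset)
  have len: "length p \<le> sum_list p" if "\<forall>k\<in>set p. k \<ge> 1" for p :: "nat list"
    using that by (induction p) auto
  show "partitions n \<subseteq> {p. set p \<subseteq> {..n} \<and> length p \<le> n}"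
    using len by (auto simp: partitions_def member_le_sum_list)
  show "finite {p. set p \<subseteq> {..n} \<and> length p \<le> n}"
    by (rule finite_lists_length_le) simp
qed

text \<open>The chromatic symmetric function depends only on the isomorphism type of the graph, so it
  suffices to let the vertices of the trees be natural numbers.\<close>

definition tree_space :: "nat \<Rightarrow> power_series set" where
  "tree_space n =
    ps.span {chromatic_sym T | T :: nat graph. tree_graph T \<and> card (verts T) = n}"

text \<open>Lists are indexed from \<open>0\<close>, so \<open>p ! 1\<close> is the second largest part.\<close>

definition caterpillar_basis :: "nat \<Rightarrow> power_series set" where
  "caterpillar_basis n =
    {chromatic_sym (caterpillar (tl p @ [hd p])) | p.
      p \<in> partitions n \<and> (p = [n] \<or> length p \<ge> 2 \<and> p ! 1 \<ge> 2)}"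

end

theory Submission
  imports Defs "HOL-Library.Multiset"
begin

text \<open>The whole argument lives in rooted forests, encoded by a parent function whose fixed points are the
  roots. Deleting the edge above a vertex, or contracting it while keeping the vertex as a leaf, then
  only changes the parent function and never the vertex set, so that all the chromatic symmetric
  functions involved count colourings of one and the same set.

  The engine is an edge exchange: if two graphs become proper for the same colourings as soon as
  \<open>u\<close> and \<open>v\<close> have equal colours, then adding the edge \<open>uv\<close> to either of them subtracts the same
  series (\<open>edge_exchange\<close>). Contracting a non-leaf edge of a forest in this way
  (\<open>deletion_near_contraction\<close>) writes the forest in terms of its deletion, its contraction, and, with
  a minus sign, the contraction with the new leaf split off. The deletion and the split contraction
  have one more component each, and the contraction has as many as the forest. Hence, if one subtracts
  from the series of each forest with \<open>c\<close> components that of the star forest \<open>hook n c\<close>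
  with \<open>c\<close> parts of which all but one are \<open>1\<close>, the recursion stays homogeneous and ends in differences
  \<open>star_diff p\<close> of two star forests with equally many components (\<open>forest_diff_in_span\<close>). For a tree,
  \<open>c = 1\<close>, this says that its series minus that of the star is a combination of such differences. The
  span of the star and all these differences is exactly the set of star combinations in which the
  coefficients of each length \<open>l \<ge> 2\<close> sum to zero (\<open>star_combinations_eq\<close>).

  It remains to generate each \<open>star_diff p\<close> from caterpillars. Only \<open>p\<close> other than a hook matters,
  since \<open>star_diff\<close> vanishes at hooks, and then \<open>p\<close> indexes a caterpillar of the basis. Order partitions
  by length, and within a length by the number of parts at least \<open>2\<close>. Modulo smaller partitions, each
  spine vertex without leaves can be contracted away at the cost of a sign (\<open>forest_diff_pendant\<close>),
  after which all remaining spine edges can be cut for free (\<open>forest_diff_cut_set\<close>), leaving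
  \<open>star_diff p\<close> up to sign. So \<open>star_diff p\<close> is in the span of the caterpillars by induction
  (\<open>star_diff_in_span_basis\<close>).

  Independence is a dimension count. The basis together with the star forests of the hooks of length
  at least \<open>2\<close> spans all star forests and has at most as many elements as there are partitions of \<open>n\<close>.
  The span of the star forests contains the power sums, which are independent because they are
  triangular with respect to length (\<open>power_sums_independent\<close>). Hence this spanning set is independent,
  and so is its subset.\<close>

section \<open>Colourings of rooted forests and exchange of edges\<close>

text \<open>Roots are the fixed points of \<open>par\<close>; a fixed point contributes no edge, so cutting the edge
  above \<open>v\<close> is the update \<open>par(v := v)\<close>.\<close>

definition parent_graph :: "'a set \<Rightarrow> ('a \<Rightarrow> 'a) \<Rightarrow> 'a graph" where
  "parent_graph V par = (V, {{v, par v} | v. v \<in> V \<and> par v \<noteq> v})"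

text \<open>The rank, which grows away from the roots, is what excludes cycles of \<open>par\<close>.\<close>

definition rooted_forest :: "'a set \<Rightarrow> ('a \<Rightarrow> 'a) \<Rightarrow> bool" where
  "rooted_forest V par \<longleftrightarrow> finite V \<and> par ` V \<subseteq> V \<and>
    (\<exists>rk :: 'a \<Rightarrow> nat. \<forall>v\<in>V. par v \<noteq> v \<longrightarrow> rk (par v) < rk v)"

definition roots :: "'a set \<Rightarrow> ('a \<Rightarrow> 'a) \<Rightarrow> 'a set" where
  "roots V par = {v \<in> V. par v = v}"

text \<open>The vertices that have a child.\<close>

definition inner :: "'a set \<Rightarrow> ('a \<Rightarrow> 'a) \<Rightarrow> 'a set" where
  "inner V par = par ` {v \<in> V. par v \<noteq> v}"

text \<open>All series of the proof have this shape, with \<open>P\<close> a list of equalities and inequalities between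
  colours of vertices. On a fixed vertex set they satisfy linear relations that come from splitting
  \<open>P\<close> into cases.\<close>

definition colour_count :: "'a set \<Rightarrow> (('a \<Rightarrow> nat) \<Rightarrow> bool) \<Rightarrow> power_series" where
  "colour_count V P = (\<lambda>m. of_nat (card
     {\<kappa> \<in> V \<rightarrow>\<^sub>E {1..}. P \<kappa> \<and> (\<Sum>v\<in>V. Poly_Mapping.single (\<kappa> v) 1) = m}))"

lemma finite_colourings:
  assumes "finite V"
  shows "finite {\<kappa> \<in> V \<rightarrow>\<^sub>E {1::nat..}. P \<kappa> \<and> (\<Sum>v\<in>V. Poly_Mapping.single (\<kappa> v) (1::nat)) = m}"
  by (rule finite_subset[OF _ finite_colourings_of_monom[of "(V, {})" m]])
     (use assms in \<open>auto simp: proper_colourings_def colour_monom_def\<close>)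

lemma colour_count_cong:
  assumes "\<And>\<kappa>. \<kappa> \<in> V \<rightarrow>\<^sub>E {1..} \<Longrightarrow> P \<kappa> \<longleftrightarrow> Q \<kappa>"
  shows "colour_count V P = colour_count V Q"
  unfolding colour_count_def using assms by (intro ext arg_cong[where f = of_nat] arg_cong[where f = card]) auto

lemma colour_count_split:
  assumes "finite V"
  shows "colour_count V P = colour_count V (\<lambda>\<kappa>. P \<kappa> \<and> Q \<kappa>) + colour_count V (\<lambda>\<kappa>. P \<kappa> \<and> \<not> Q \<kappa>)"
proof
  fix m
  let ?S = "\<lambda>P. {\<kappa> \<in> V \<rightarrow>\<^sub>E {1::nat..}. P \<kappa> \<and> (\<Sum>v\<in>V. Poly_Mapping.single (\<kappa> v) (1::nat)) = m}"
  have "card (?S P) = card (?S (\<lambda>\<kappa>. P \<kappa> \<and> Q \<kappa>) \<union> ?S (\<lambda>\<kappa>. P \<kappa> \<and> \<not> Q \<kappa>))"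
    by (rule arg_cong[where f = card]) auto
  also have "\<dots> = card (?S (\<lambda>\<kappa>. P \<kappa> \<and> Q \<kappa>)) + card (?S (\<lambda>\<kappa>. P \<kappa> \<and> \<not> Q \<kappa>))"
    by (rule card_Un_disjoint[OF finite_colourings[OF assms] finite_colourings[OF assms]]) blast
  finally show "colour_count V P m = (colour_count V (\<lambda>\<kappa>. P \<kappa> \<and> Q \<kappa>)
      + colour_count V (\<lambda>\<kappa>. P \<kappa> \<and> \<not> Q \<kappa>)) m"
    by (simp add: colour_count_def)
qed

lemma chromatic_sym_parent_graph:
  assumes "par ` V \<subseteq> V"
  shows "chromatic_sym (parent_graph V par) =
    colour_count V (\<lambda>\<kappa>. \<forall>v\<in>V. par v \<noteq> v \<longrightarrow> \<kappa> v \<noteq> \<kappa> (par v))"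
proof -
  have "(\<forall>u w. {u, w} \<in> edges (parent_graph V par) \<longrightarrow> \<kappa> u \<noteq> \<kappa> w) \<longleftrightarrow>
     (\<forall>v\<in>V. par v \<noteq> v \<longrightarrow> \<kappa> v \<noteq> \<kappa> (par v))" for \<kappa> :: "'a \<Rightarrow> nat"
    by (fastforce simp: parent_graph_def doubleton_eq_iff)
  thus ?thesis
    unfolding chromatic_sym_def colour_count_def proper_colourings_def colour_monom_def
    by (simp add: parent_graph_def conj_assoc)
qed

text \<open>Adding the edge \<open>uv\<close> removes exactly the colourings with \<open>\<kappa> u = \<kappa> v\<close>, and on those \<open>P\<close> and \<open>Q\<close>
  are the same condition.\<close>

lemma edge_exchange:
  assumes V: "finite V"
    and "\<And>\<kappa>. \<kappa> u = \<kappa> v \<Longrightarrow> P \<kappa> \<longleftrightarrow> Q \<kappa>"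
  shows "colour_count V (\<lambda>\<kappa>. P \<kappa> \<and> \<kappa> u \<noteq> \<kappa> v) =
    colour_count V P + colour_count V (\<lambda>\<kappa>. Q \<kappa> \<and> \<kappa> u \<noteq> \<kappa> v) - colour_count V Q"
proof -
  have "colour_count V (\<lambda>\<kappa>. P \<kappa> \<and> \<kappa> u = \<kappa> v) = colour_count V (\<lambda>\<kappa>. Q \<kappa> \<and> \<kappa> u = \<kappa> v)"
    by (rule colour_count_cong) (use assms in auto)
  thus ?thesis
    using colour_count_split[OF V, of P "\<lambda>\<kappa>. \<kappa> u = \<kappa> v"]
      colour_count_split[OF V, of Q "\<lambda>\<kappa>. \<kappa> u = \<kappa> v"]
    by (simp add: algebra_simps)
qed

definition proper :: "'a set \<Rightarrow> ('a \<Rightarrow> 'a) \<Rightarrow> ('a \<Rightarrow> nat) \<Rightarrow> bool" where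
  "proper V par \<kappa> \<longleftrightarrow> (\<forall>v\<in>V. par v \<noteq> v \<longrightarrow> \<kappa> v \<noteq> \<kappa> (par v))"

lemma chromatic_sym_rooted_forest:
  "rooted_forest V par \<Longrightarrow> chromatic_sym (parent_graph V par) = colour_count V (proper V par)"
  unfolding rooted_forest_def proper_def by (intro chromatic_sym_parent_graph) auto

lemma proper_cut:
  assumes "v \<in> V" "par v \<noteq> v"
  shows "proper V par \<kappa> \<longleftrightarrow> proper V (par(v := v)) \<kappa> \<and> \<kappa> v \<noteq> \<kappa> (par v)"
proof
  assume P: "proper V par \<kappa>"
  have "\<kappa> w \<noteq> \<kappa> ((par(v := v)) w)" if "w \<in> V" "(par(v := v)) w \<noteq> w" for w
    using P that by (cases "w = v") (simp_all add: proper_def)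
  thus "proper V (par(v := v)) \<kappa> \<and> \<kappa> v \<noteq> \<kappa> (par v)"
    using P assms by (simp add: proper_def)
next
  assume P: "proper V (par(v := v)) \<kappa> \<and> \<kappa> v \<noteq> \<kappa> (par v)"
  have "\<kappa> w \<noteq> \<kappa> (par w)" if "w \<in> V" "par w \<noteq> w" for w
    using P that unfolding proper_def by (cases "w = v") force+
  thus "proper V par \<kappa>" by (simp add: proper_def)
qed

text \<open>Contraction of the edge above \<open>v\<close>, followed by attaching a new leaf to the merged vertex: the
  children of \<open>v\<close> move to the parent of \<open>v\<close>, and \<open>v\<close> itself plays the role of the new leaf.\<close>

definition contract :: "('a \<Rightarrow> 'a) \<Rightarrow> 'a \<Rightarrow> 'a \<Rightarrow> 'a" where
  "contract par v = (\<lambda>w. if par w = v then par v else par w)"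

lemma rooted_forestE:
  assumes "rooted_forest V par"
  obtains rk :: "'a \<Rightarrow> nat" where "finite V" "par ` V \<subseteq> V"
    "\<And>v. v \<in> V \<Longrightarrow> par v \<noteq> v \<Longrightarrow> rk (par v) < rk v"
  using assms unfolding rooted_forest_def by blast

lemma rooted_forestI:
  assumes "finite V" "\<And>v. v \<in> V \<Longrightarrow> par v \<in> V"
    "\<And>v. v \<in> V \<Longrightarrow> par v \<noteq> v \<Longrightarrow> (rk (par v) :: nat) < rk v"
  shows "rooted_forest V par"
  using assms unfolding rooted_forest_def by blast

lemma rooted_forest_cut:
  assumes "rooted_forest V par"
  shows "rooted_forest V (par(v := v))"
proof -
  from assms obtain rk where rk: "finite V" "par ` V \<subseteq> V"
    "\<And>v. v \<in> V \<Longrightarrow> par v \<noteq> v \<Longrightarrow> rk (par v) < (rk v :: nat)"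
    by (rule rooted_forestE) blast
  show ?thesis
    by (rule rooted_forestI[where rk = rk]) (use rk in \<open>auto split: if_splits\<close>)
qed

lemma rooted_forest_contract:
  assumes "rooted_forest V par" "v \<in> V"
  shows "rooted_forest V (contract par v)"
proof -
  from assms(1) obtain rk where rk: "finite V" "par ` V \<subseteq> V"
    "\<And>v. v \<in> V \<Longrightarrow> par v \<noteq> v \<Longrightarrow> rk (par v) < (rk v :: nat)"
    by (rule rooted_forestE) blast
  show ?thesis
  proof (rule rooted_forestI)
    fix w assume w: "w \<in> V" "contract par v w \<noteq> w"
    show "rk (contract par v w) < rk w"
    proof (cases "par w = v \<and> w \<noteq> v")
      case True
      hence "rk v < rk w" using rk(3)[OF w(1)] by auto
      thus ?thesis using True rk(3)[OF assms(2)] by (cases "par v = v") (auto simp: contract_def)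
    next
      case False
      thus ?thesis using w rk(3)[OF w(1)] by (auto simp: contract_def split: if_splits)
    qed
  qed (use rk assms in \<open>auto simp: contract_def\<close>)
qed

text \<open>The only way for \<open>w\<close> to become a root would be that \<open>w\<close> is a child of \<open>v\<close> and also its parent,
  which the rank forbids.\<close>

lemma contract_nonroot_iff:
  assumes "rooted_forest V par" "v \<in> V" "par v \<noteq> v" "w \<in> V"
  shows "contract par v w = w \<longleftrightarrow> par w = w"
proof -
  from assms(1) obtain rk where rk:
    "\<And>v. v \<in> V \<Longrightarrow> par v \<noteq> v \<Longrightarrow> rk (par v) < (rk v :: nat)"
    by (rule rooted_forestE) blast
  show ?thesis
    using rk[OF assms(2,3)] rk[OF assms(4)] assms(3)
    by (cases "par w = v") (auto simp: contract_def)
qed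

text \<open>The edge above \<open>u\<close> in the first forest and the edge above \<open>u'\<close> in the second are required to be the same
  edge, but may be oriented differently.\<close>

lemma forest_exchange:
  assumes F: "rooted_forest V par" "rooted_forest V par'"
    and e: "u \<in> V" "par u \<noteq> u" "u' \<in> V" "par' u' \<noteq> u'" "{u, par u} = {u', par' u'}"
    and eq: "\<And>\<kappa>. \<kappa> u = \<kappa> (par u) \<Longrightarrow> proper V (par(u := u)) \<kappa> \<longleftrightarrow> proper V (par'(u' := u')) \<kappa>"
  shows "chromatic_sym (parent_graph V par) =
    chromatic_sym (parent_graph V (par(u := u)))
    + chromatic_sym (parent_graph V par')
    - chromatic_sym (parent_graph V (par'(u' := u')))"
proof -
  have fin: "finite V" using F by (simp add: rooted_forest_def)
  have "proper V par' \<kappa> \<longleftrightarrow> proper V (par'(u' := u')) \<kappa> \<and> \<kappa> u \<noteq> \<kappa> (par u)" for \<kappa>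
    unfolding proper_cut[of u' V par', OF e(3,4)] using e(5) by (metis doubleton_eq_iff)
  hence "proper V par' = (\<lambda>\<kappa>. proper V (par'(u' := u')) \<kappa> \<and> \<kappa> u \<noteq> \<kappa> (par u))" by blast
  moreover have "proper V par = (\<lambda>\<kappa>. proper V (par(u := u)) \<kappa> \<and> \<kappa> u \<noteq> \<kappa> (par u))"
    using proper_cut[of u V par] e by blast
  ultimately show ?thesis
    using edge_exchange[OF fin, of u "par u" "proper V (par(u := u))" "proper V (par'(u' := u'))"] eq
    by (simp only: chromatic_sym_rooted_forest F rooted_forest_cut)
qed

text \<open>When \<open>v\<close> and its parent share a colour, an edge from \<open>v\<close> to a child imposes the same condition as
  an edge from the parent of \<open>v\<close> to that child.\<close>

lemma deletion_near_contraction: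
  assumes F: "rooted_forest V par" and v: "v \<in> V" "par v \<noteq> v"
  shows "chromatic_sym (parent_graph V par) =
    chromatic_sym (parent_graph V (par(v := v)))
    + chromatic_sym (parent_graph V (contract par v))
    - chromatic_sym (parent_graph V ((contract par v)(v := v)))"
proof (rule forest_exchange)
  have [simp]: "contract par v v = par v" by (simp add: contract_def)
  show "contract par v v \<noteq> v" "{v, par v} = {v, contract par v v}" using v by simp_all
  fix \<kappa> :: "'a \<Rightarrow> nat" assume eq: "\<kappa> v = \<kappa> (par v)"
  show "proper V (par(v := v)) \<kappa> \<longleftrightarrow> proper V ((contract par v)(v := v)) \<kappa>"
    unfolding proper_def
  proof (intro ball_cong refl)
    fix w assume w: "w \<in> V"
    show "((par(v := v)) w \<noteq> w \<longrightarrow> \<kappa> w \<noteq> \<kappa> ((par(v := v)) w)) \<longleftrightarrow>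
      (((contract par v)(v := v)) w \<noteq> w \<longrightarrow> \<kappa> w \<noteq> \<kappa> (((contract par v)(v := v)) w))"
    proof (cases "w = v")
      case False
      have "\<kappa> (contract par v w) = \<kappa> (par w)" using eq by (simp add: contract_def)
      thus ?thesis using False contract_nonroot_iff[OF F v w] by simp
    qed simp
  qed
qed (use assms in \<open>simp_all add: rooted_forest_contract\<close>)

text \<open>The same contraction performed downwards: here \<open>p\<close> is absorbed into its only child \<open>v\<close>, which
  inherits the edge above \<open>p\<close>, and \<open>p\<close> becomes a leaf below \<open>v\<close>. In contrast to an upward contraction,
  \<open>v\<close> keeps its children, so this removes a leafless spine vertex without touching the stars around it.\<close>

lemma pendant_exchange:
  assumes F: "rooted_forest V par" and v: "v \<in> V" "par v = p" "p \<noteq> v" "par p \<noteq> p"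
    and only: "\<And>w. w \<in> V \<Longrightarrow> par w = p \<Longrightarrow> w = v"
  shows "rooted_forest V (par(v := par p, p := v))"
    and "chromatic_sym (parent_graph V par) =
    chromatic_sym (parent_graph V (par(v := v)))
    + chromatic_sym (parent_graph V (par(v := par p, p := v)))
    - chromatic_sym (parent_graph V (par(v := par p, p := p)))"
proof -
  from F obtain rk where rk: "finite V" "par ` V \<subseteq> V"
    "\<And>v. v \<in> V \<Longrightarrow> par v \<noteq> v \<Longrightarrow> rk (par v) < (rk v :: nat)"
    by (rule rooted_forestE) blast
  have p: "p \<in> V" using rk v by auto
  have less: "rk p < rk v" "rk (par p) < rk p" using rk(3)[of v] rk(3)[of p] p v by auto
  hence neq: "par p \<noteq> v" by auto
  show F1: "rooted_forest V (par(v := par p, p := v))"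
  proof (rule rooted_forestI)
    fix w assume w: "w \<in> V" "(par(v := par p, p := v)) w \<noteq> w"
    consider "w = p" | "w = v" | "w \<noteq> p" "w \<noteq> v" by blast
    \<comment> \<open>The vertex \<open>p\<close> has no children any more, so its rank can be raised freely.\<close>
    thus "(rk(p := Suc (rk v))) ((par(v := par p, p := v)) w) < (rk(p := Suc (rk v))) w"
    proof cases
      case 3
      thus ?thesis using rk(3)[OF w(1)] only[OF w(1)] w(2) by auto
    qed (use less v in auto)
  qed (use rk p v in auto)
  have "chromatic_sym (parent_graph V par) =
    chromatic_sym (parent_graph V (par(v := v)))
    + chromatic_sym (parent_graph V (par(v := par p, p := v)))
    - chromatic_sym (parent_graph V ((par(v := par p, p := v))(p := p)))"
  proof (rule forest_exchange[OF F F1])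
    fix \<kappa> :: "'a \<Rightarrow> nat" assume eq: "\<kappa> v = \<kappa> (par v)"
    have split: "proper V q \<kappa> \<longleftrightarrow> (q v \<noteq> v \<longrightarrow> \<kappa> v \<noteq> \<kappa> (q v)) \<and> (q p \<noteq> p \<longrightarrow> \<kappa> p \<noteq> \<kappa> (q p))
      \<and> (\<forall>w\<in>V - {v, p}. q w \<noteq> w \<longrightarrow> \<kappa> w \<noteq> \<kappa> (q w))" for q
      using p v(1) by (auto simp: proper_def)
    have "(\<forall>w\<in>V - {v, p}. (par(v := v)) w \<noteq> w \<longrightarrow> \<kappa> w \<noteq> \<kappa> ((par(v := v)) w)) \<longleftrightarrow>
      (\<forall>w\<in>V - {v, p}. (par(v := par p, p := p)) w \<noteq> w \<longrightarrow> \<kappa> w \<noteq> \<kappa> ((par(v := par p, p := p)) w))"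
      by (intro ball_cong refl) simp
    thus "proper V (par(v := v)) \<kappa> \<longleftrightarrow> proper V ((par(v := par p, p := v))(p := p)) \<kappa>"
      unfolding split[of "par(v := v)"] split[of "(par(v := par p, p := v))(p := p)"]
      using v neq eq by simp
  qed (use v p in auto)
  thus "chromatic_sym (parent_graph V par) =
    chromatic_sym (parent_graph V (par(v := v)))
    + chromatic_sym (parent_graph V (par(v := par p, p := v)))
    - chromatic_sym (parent_graph V (par(v := par p, p := p)))" by simp
qed

section \<open>Forests of depth one are star forests\<close>

lemma colour_count_bij:
  assumes f: "bij_betw f V W"
    and eq: "\<And>\<kappa>. Q \<kappa> \<longleftrightarrow> P (restrict (\<kappa> \<circ> f) V)"
  shows "colour_count W Q = colour_count V P"
proof
  fix m
  let ?S = "\<lambda>V P. {\<kappa> \<in> V \<rightarrow>\<^sub>E {1::nat..}. P \<kappa> \<and> (\<Sum>v\<in>V. Poly_Mapping.single (\<kappa> v) (1::nat)) = m}"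
  let ?h = "\<lambda>\<kappa>. restrict (\<kappa> \<circ> f) V"
  let ?k = "\<lambda>\<kappa>. restrict (\<kappa> \<circ> inv_into V f) W"
  have fW: "f v \<in> W" if "v \<in> V" for v using f that by (auto simp: bij_betw_def)
  have gV: "inv_into V f w \<in> V" if "w \<in> W" for w using f that by (auto simp: bij_betw_def inv_into_into)
  have gf: "inv_into V f (f v) = v" if "v \<in> V" for v using f that by (auto simp: bij_betw_def)
  have fg: "f (inv_into V f w) = w" if "w \<in> W" for w using f that by (auto simp: bij_betw_def f_inv_into_f)
  have hk: "?h (?k \<kappa>) = \<kappa>" if "\<kappa> \<in> V \<rightarrow>\<^sub>E {1::nat..}" for \<kappa>
    using that by (auto simp: fun_eq_iff gf fW PiE_iff extensional_def)
  have kh: "?k (?h \<kappa>) = \<kappa>" if "\<kappa> \<in> W \<rightarrow>\<^sub>E {1::nat..}" for \<kappa>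
    using that by (auto simp: fun_eq_iff fg gV PiE_iff extensional_def)
  have sum: "(\<Sum>v\<in>V. Poly_Mapping.single (?h \<kappa> v) (1::nat)) = (\<Sum>w\<in>W. Poly_Mapping.single (\<kappa> w) 1)" for \<kappa>
    using sum.reindex_bij_betw[OF f, of "\<lambda>w. Poly_Mapping.single (\<kappa> w) (1::nat)"] by simp
  have "bij_betw ?h (?S W Q) (?S V P)"
  proof (rule bij_betw_byWitness[where f' = ?k])
    show "?h ` ?S W Q \<subseteq> ?S V P"
    proof safe
      fix \<kappa> assume \<kappa>: "\<kappa> \<in> W \<rightarrow>\<^sub>E {1::nat..}" "Q \<kappa>"
      show "P (?h \<kappa>)" using \<kappa>(2) by (simp add: eq)
      show "(\<Sum>v\<in>V. Poly_Mapping.single (?h \<kappa> v) (1::nat)) = (\<Sum>w\<in>W. Poly_Mapping.single (\<kappa> w) 1)"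
        by (rule sum)
    qed (use fW in \<open>auto simp: PiE_iff\<close>)
    show "?k ` ?S V P \<subseteq> ?S W Q"
    proof safe
      fix \<kappa> assume \<kappa>: "\<kappa> \<in> V \<rightarrow>\<^sub>E {1::nat..}" "P \<kappa>"
      show "Q (?k \<kappa>)" using hk[OF \<kappa>(1)] \<kappa>(2) by (simp add: eq)
      show "(\<Sum>w\<in>W. Poly_Mapping.single (?k \<kappa> w) 1) = (\<Sum>v\<in>V. Poly_Mapping.single (\<kappa> v) (1::nat))"
        using sum[of "?k \<kappa>"] hk[OF \<kappa>(1)] by simp
    qed (use gV in \<open>auto simp: PiE_iff\<close>)
  qed (use hk kh in blast)+
  thus "colour_count W Q m = colour_count V P m"
    unfolding colour_count_def by (simp add: bij_betw_same_card)
qed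

lemma chromatic_sym_forest_iso:
  assumes F: "rooted_forest V par" and F': "rooted_forest W par'"
    and f: "bij_betw f V W" and par: "\<And>v. v \<in> V \<Longrightarrow> par' (f v) = f (par v)"
  shows "chromatic_sym (parent_graph W par') = chromatic_sym (parent_graph V par)"
  unfolding F[THEN chromatic_sym_rooted_forest] F'[THEN chromatic_sym_rooted_forest]
proof (rule colour_count_bij[OF f])
  fix \<kappa> :: "'b \<Rightarrow> nat"
  have V: "v \<in> V \<Longrightarrow> par v \<in> V" for v using F by (auto simp: rooted_forest_def)
  have W: "W = f ` V" and inj: "inj_on f V" using f by (auto simp: bij_betw_def)
  show "proper W par' \<kappa> \<longleftrightarrow> proper V par (restrict (\<kappa> \<circ> f) V)"
    by (auto simp: proper_def W par V inj_on_eq_iff[OF inj])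
qed

text \<open>The common vertex set of \<open>star_forest \<alpha>\<close> and \<open>caterpillar \<alpha>\<close>.\<close>

definition cells :: "nat list \<Rightarrow> (nat \<times> nat) set" where
  "cells \<alpha> = {(i, j). i < length \<alpha> \<and> j < \<alpha> ! i}"

text \<open>Leaves hang from the centre of their star, and the centre of star \<open>i\<close> hangs from the centre of
  star \<open>nx i\<close>. Thus \<open>nx = (\<lambda>i. i)\<close> gives the star forest, and the successor function gives the
  caterpillar, rooted at the end of its spine.\<close>

definition star_par :: "(nat \<Rightarrow> nat) \<Rightarrow> nat \<times> nat \<Rightarrow> nat \<times> nat" where
  "star_par nx = (\<lambda>(i, j). if j = 0 then (nx i, 0) else (i, 0))"

lemma finite_cells: "finite (cells \<alpha>)"
  by (rule finite_subset[of _ "{..<length \<alpha>} \<times> {..<sum_list \<alpha> + 1}"])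
     (auto simp: cells_def dest: elem_le_sum_list)

lemma star_forest_eq: "star_forest p = parent_graph (cells p) (star_par (\<lambda>i. i))"
proof -
  have "edges (star_forest p) = {{(i, 0), (i, j)} | i j. i < length p \<and> 1 \<le> j \<and> j < p ! i}"
  proof (intro equalityI subsetI)
    fix e assume "e \<in> edges (star_forest p)"
    then obtain i j where "e = Pair i ` {0, j}" "i < length p" "1 \<le> j" "j < p ! i"
      by (auto simp: star_forest_def disjoint_union_def star_def)
    thus "e \<in> {{(i, 0), (i, j)} | i j. i < length p \<and> 1 \<le> j \<and> j < p ! i}" by auto
  next
    fix e assume "e \<in> {{(i, 0 :: nat), (i, j)} | i j. i < length p \<and> 1 \<le> j \<and> j < p ! i}"
    then obtain i j where ij: "e = {(i, 0), (i, j)}" "i < length p" "1 \<le> j" "j < p ! i" by blast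
    hence "e = Pair i ` {0, j} \<and> i < length (map star p) \<and> {0, j} \<in> edges (map star p ! i)"
      by (auto simp: star_def)
    thus "e \<in> edges (star_forest p)"
      unfolding star_forest_def disjoint_union_def snd_conv by blast
  qed
  also have "\<dots> = {{v, star_par (\<lambda>i. i) v} | v. v \<in> cells p \<and> star_par (\<lambda>i. i) v \<noteq> v}"
  proof (intro equalityI subsetI)
    fix e assume "e \<in> {{(i, 0 :: nat), (i, j)} | i j. i < length p \<and> 1 \<le> j \<and> j < p ! i}"
    then obtain i j where ij: "e = {(i, 0), (i, j)}" "i < length p" "1 \<le> j" "j < p ! i" by blast
    hence "e = {(i, j), star_par (\<lambda>i. i) (i, j)} \<and> (i, j) \<in> cells p \<and> star_par (\<lambda>i. i) (i, j) \<noteq> (i, j)"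
      by (auto simp: star_par_def cells_def)
    thus "e \<in> {{v, star_par (\<lambda>i. i) v} | v. v \<in> cells p \<and> star_par (\<lambda>i. i) v \<noteq> v}" by blast
  next
    fix e assume "e \<in> {{v, star_par (\<lambda>i. i) v} | v. v \<in> cells p \<and> star_par (\<lambda>i. i) v \<noteq> v}"
    then obtain i j where ij: "e = {(i, j), star_par (\<lambda>i. i) (i, j)}" "(i, j) \<in> cells p"
      "star_par (\<lambda>i. i) (i, j) \<noteq> (i, j)" by auto
    hence "e = {(i, 0), (i, j)} \<and> i < length p \<and> 1 \<le> j \<and> j < p ! i"
      by (auto simp: star_par_def cells_def split: if_splits)
    thus "e \<in> {{(i, 0 :: nat), (i, j)} | i j. i < length p \<and> 1 \<le> j \<and> j < p ! i}" by blast
  qed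
  finally have "edges (star_forest p) = edges (parent_graph (cells p) (star_par (\<lambda>i. i)))"
    by (simp add: parent_graph_def)
  moreover have "verts (star_forest p) = verts (parent_graph (cells p) (star_par (\<lambda>i. i)))"
    by (auto simp: star_forest_def disjoint_union_def parent_graph_def cells_def star_def)
  ultimately show ?thesis by (rule prod_eqI[rotated])
qed

text \<open>A rank must decrease towards the root, so a centre is ranked by how many centres come after it.\<close>

lemma rooted_forest_star_par:
  assumes pos: "\<forall>k\<in>set \<alpha>. k \<ge> 1"
    and nx: "\<And>i. i < length \<alpha> \<Longrightarrow> i \<le> nx i \<and> nx i < length \<alpha>"
  shows "rooted_forest (cells \<alpha>) (star_par nx)"
proof (rule rooted_forestI)
  fix v assume v: "v \<in> cells \<alpha>"
  show "star_par nx v \<in> cells \<alpha>"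
  proof -
    obtain i j where [simp]: "v = (i, j)" by force
    have i: "i < length \<alpha>" "j < \<alpha> ! i" using v by (simp_all add: cells_def)
    have "\<alpha> ! nx i > 0" "nx i < length \<alpha>" using pos nx[OF i(1)] by (auto simp: Suc_le_eq)
    thus ?thesis using i by (simp add: cells_def star_par_def)
  qed
  assume "star_par nx v \<noteq> v"
  thus "(\<lambda>(i, j). if j = 0 then length \<alpha> - i else length \<alpha> + 1) (star_par nx v) <
    (\<lambda>(i, j). if j = 0 then length \<alpha> - i else length \<alpha> + 1) v"
    using v nx[of "fst v"] by (auto simp: cells_def star_par_def split: prod.splits if_splits)
qed (rule finite_cells)

lemma image_mset_eq_mset_map:
  "image_mset f M = mset ys \<Longrightarrow> \<exists>xs. mset xs = M \<and> map f xs = ys"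
proof (induction ys arbitrary: M)
  case (Cons y ys)
  then obtain x N where "M = add_mset x N" "f x = y" "image_mset f N = mset ys"
    using msed_map_invR[of f M y "mset ys"] by auto
  with Cons.IH[of N] show ?case
    by (metis list.simps(9) mset.simps(2))
qed auto

text \<open>If every child hangs from a root, the components are stars whose centres are the roots, and the
  vertices can be numbered star by star in any prescribed order of the sizes.\<close>

lemma chromatic_sym_flat_forest:
  assumes F: "rooted_forest V par" and flat: "inner V par \<subseteq> roots V par"
    and \<mu>: "mset \<mu> = image_mset (\<lambda>r. card {w \<in> V. par w = r}) (mset_set (roots V par))"
  shows "chromatic_sym (parent_graph V par) = chromatic_sym (star_forest \<mu>)"
proof -
  have fin: "finite V" and parV: "par ` V \<subseteq> V" using F by (auto simp: rooted_forest_def)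
  have finR: "finite (roots V par)" using fin by (simp add: roots_def)
  have par_root: "par v \<in> roots V par" if "v \<in> V" for v
    using flat that by (cases "par v = v") (auto simp: inner_def roots_def)
  obtain rs where rs: "mset rs = mset_set (roots V par)"
    and map_rs: "map (\<lambda>r. card {w \<in> V. par w = r}) rs = \<mu>"
    using image_mset_eq_mset_map[OF \<mu>[symmetric]] by blast
  have set_rs: "set rs = roots V par" using rs finR by (metis finite_set_mset_mset_set set_mset_mset)
  have dist: "distinct rs" using finR by (auto simp: distinct_count_atmost_1 rs count_mset_set' simp flip: set_rs)
  have len: "length \<mu> = length rs" using map_rs by auto
  have size: "\<mu> ! i = card {w \<in> V. par w = rs ! i}" if "i < length rs" for i
    using that by (simp add: map_rs[symmetric])
  have "\<exists>g. bij_betw g {..<card {w \<in> V. par w = r}} {w \<in> V. par w = r} \<and> g 0 = r"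
    if r: "r \<in> roots V par" for r
  proof -
    let ?A = "{w \<in> V. par w = r}"
    have "r \<in> ?A" "finite ?A" using r fin by (auto simp: roots_def)
    hence "\<exists>g. bij_betw g {1..<card ?A} (?A - {r})"
      by (intro finite_same_card_bij) auto
    then obtain g where g: "bij_betw g {1..<card ?A} (?A - {r})" ..
    have pos: "card ?A > 0" using \<open>r \<in> ?A\<close> \<open>finite ?A\<close> by (auto simp: card_gt_0_iff)
    have "bij_betw (g(0 := r)) {0} {r}" by (simp add: bij_betw_def)
    moreover have "bij_betw (g(0 := r)) {1..<card ?A} (?A - {r})"
      using g by (subst bij_betw_cong[of _ _ g]) auto
    ultimately have "bij_betw (g(0 := r)) ({0} \<union> {1..<card ?A}) ({r} \<union> (?A - {r}))"
      by (rule bij_betw_combine) auto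
    moreover have "{0} \<union> {1..<card ?A} = {..<card ?A}" "{r} \<union> (?A - {r}) = ?A"
      using pos \<open>r \<in> ?A\<close> by auto
    ultimately have "bij_betw (g(0 := r)) {..<card ?A} ?A" by (simp only:)
    thus ?thesis by (intro exI[of _ "g(0 := r)"]) simp
  qed
  hence "\<forall>r\<in>roots V par. \<exists>g. bij_betw g {..<card {w \<in> V. par w = r}} {w \<in> V. par w = r} \<and> g 0 = r"
    by blast
  from bchoice[OF this] obtain g where g: "\<And>r. r \<in> roots V par \<Longrightarrow>
      bij_betw (g r) {..<card {w \<in> V. par w = r}} {w \<in> V. par w = r} \<and> g r 0 = r"
    by blast
  define f where "f = (\<lambda>(i, j). g (rs ! i) j)"
  have f_in: "f (i, j) \<in> V \<and> par (f (i, j)) = rs ! i" if "(i, j) \<in> cells \<mu>" for i j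
  proof -
    have "i < length rs" "j < card {w \<in> V. par w = rs ! i}"
      using that by (auto simp: cells_def len size)
    moreover from this have "rs ! i \<in> roots V par" using set_rs nth_mem by blast
    ultimately show ?thesis using g[of "rs ! i"] by (auto simp: f_def bij_betw_def)
  qed
  have bij: "bij_betw f (cells \<mu>) V"
    unfolding bij_betw_def
  proof
    show "inj_on f (cells \<mu>)"
    proof (rule inj_onI, safe)
      fix i j i' j' assume c: "(i, j) \<in> cells \<mu>" "(i', j') \<in> cells \<mu>" and eq: "f (i, j) = f (i', j')"
      have "rs ! i = rs ! i'" using f_in[OF c(1)] f_in[OF c(2)] eq by metis
      moreover have i: "i < length rs" "i' < length rs" using c by (auto simp: cells_def len)
      ultimately show "i = i'" using dist by (simp add: nth_eq_iff_index_eq)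
      moreover have "rs ! i \<in> roots V par" using i set_rs nth_mem by blast
      ultimately show "j = j'"
        using g[of "rs ! i"] eq c i by (auto simp: f_def bij_betw_def inj_on_def cells_def size)
    qed
    show "f ` cells \<mu> = V"
    proof
      show "f ` cells \<mu> \<subseteq> V" using f_in by auto
      show "V \<subseteq> f ` cells \<mu>"
      proof
        fix v assume v: "v \<in> V"
        then obtain i where i: "i < length rs" "par v = rs ! i"
          using par_root set_rs by (metis in_set_conv_nth)
        hence "v \<in> g (rs ! i) ` {..<card {w \<in> V. par w = rs ! i}}"
          using g[of "rs ! i"] par_root[OF v] v by (auto simp: bij_betw_def)
        then obtain j where "j < \<mu> ! i" "v = f (i, j)" by (auto simp: f_def size i)
        thus "v \<in> f ` cells \<mu>" using i by (auto simp: cells_def len)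
      qed
    qed
  qed
  have pos: "\<forall>k\<in>set \<mu>. k \<ge> 1"
  proof
    fix k assume "k \<in> set \<mu>"
    then obtain r where r: "r \<in> roots V par" "k = card {w \<in> V. par w = r}"
      using set_rs by (auto simp: map_rs[symmetric])
    hence "r \<in> {w \<in> V. par w = r}" by (auto simp: roots_def)
    moreover have "finite {w \<in> V. par w = r}" using fin by simp
    ultimately show "k \<ge> 1" using r by (metis One_nat_def Suc_leI card_gt_0_iff empty_iff)
  qed
  show ?thesis unfolding star_forest_eq
  proof (rule chromatic_sym_forest_iso[OF _ F bij])
    show "rooted_forest (cells \<mu>) (star_par (\<lambda>i. i))"
      by (rule rooted_forest_star_par[OF pos]) simp
    fix v assume v: "v \<in> cells \<mu>"
    obtain i j where ij: "v = (i, j)" by force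
    hence i: "i < length rs" using v by (auto simp: cells_def len)
    hence "g (rs ! i) 0 = rs ! i" using g set_rs nth_mem by blast
    thus "par (f v) = f (star_par (\<lambda>i. i) v)"
      using f_in[of i j] v ij by (simp add: star_par_def f_def)
  qed
qed

definition flat_type :: "'a set \<Rightarrow> ('a \<Rightarrow> 'a) \<Rightarrow> nat list" where
  "flat_type V par = rev (sorted_list_of_multiset
     (image_mset (\<lambda>r. card {w \<in> V. par w = r}) (mset_set (roots V par))))"

definition big_parts :: "nat list \<Rightarrow> nat" where
  "big_parts p = length (filter (\<lambda>k. k \<ge> 2) p)"

lemma flat_type:
  assumes F: "rooted_forest V par" and flat: "inner V par \<subseteq> roots V par"
  shows "flat_type V par \<in> partitions (card V)"
    and "length (flat_type V par) = card (roots V par)"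
    and "big_parts (flat_type V par) = card (inner V par)"
    and "chromatic_sym (parent_graph V par) = chromatic_sym (star_forest (flat_type V par))"
proof -
  let ?s = "\<lambda>r. card {w \<in> V. par w = r}"
  have fin: "finite V" and parV: "par ` V \<subseteq> V" using F by (auto simp: rooted_forest_def)
  have finR: "finite (roots V par)" using fin by (simp add: roots_def)
  have par_root: "par v \<in> roots V par" if "v \<in> V" for v
    using flat that by (cases "par v = v") (auto simp: inner_def roots_def)
  have mset: "mset (flat_type V par) = image_mset ?s (mset_set (roots V par))"
    by (simp add: flat_type_def)
  have "sum_list (flat_type V par) = (\<Sum>r\<in>roots V par. ?s r)"
    by (simp flip: sum_mset_sum_list add: mset sum_unfold_sum_mset)
  also have "\<dots> = card (\<Union>r\<in>roots V par. {w \<in> V. par w = r})"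
    using fin finR by (subst card_UN_disjoint) auto
  also have "(\<Union>r\<in>roots V par. {w \<in> V. par w = r}) = V" using par_root by auto
  finally have sum: "sum_list (flat_type V par) = card V" .
  have pos: "\<forall>k\<in>set (flat_type V par). k \<ge> 1"
  proof
    fix k assume "k \<in> set (flat_type V par)"
    hence "k \<in># image_mset ?s (mset_set (roots V par))" by (metis mset set_mset_mset)
    then obtain r where r: "r \<in> roots V par" "k = ?s r" using finR by auto
    hence "r \<in> {w \<in> V. par w = r}" by (auto simp: roots_def)
    moreover have "finite {w \<in> V. par w = r}" using fin by simp
    ultimately show "k \<ge> 1" using r by (metis One_nat_def Suc_leI card_gt_0_iff empty_iff)
  qed
  have "sorted_wrt (\<ge>) (flat_type V par)"
    by (simp add: flat_type_def sorted_wrt_rev sorted_sorted_list_of_multiset)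
  with sum pos show "flat_type V par \<in> partitions (card V)" by (simp add: partitions_def)
  show "length (flat_type V par) = card (roots V par)"
    by (metis mset size_image_mset size_mset size_mset_set)
  have "big_parts (flat_type V par) = size (filter_mset (\<lambda>k. k \<ge> 2) (mset (flat_type V par)))"
    by (simp add: big_parts_def flip: mset_filter)
  also have "\<dots> = card {r \<in> roots V par. ?s r \<ge> 2}"
    by (simp add: mset filter_mset_image_mset finR)
  also have "{r \<in> roots V par. ?s r \<ge> 2} = inner V par"
  proof (intro equalityI subsetI)
    fix r assume "r \<in> {r \<in> roots V par. ?s r \<ge> 2}"
    hence r: "r \<in> V" "par r = r" "\<not> ?s r \<le> Suc 0" by (auto simp: roots_def)
    have "\<exists>w\<in>V. par w = r \<and> w \<noteq> r"
    proof (rule ccontr)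
      assume "\<not> ?thesis"
      hence "{w \<in> V. par w = r} \<subseteq> {r}" by auto
      with r(3) show False using card_mono[of "{r}" "{w \<in> V. par w = r}"] by simp
    qed
    thus "r \<in> inner V par" by (auto simp: inner_def)
  next
    fix r assume r: "r \<in> inner V par"
    then obtain w where w: "w \<in> V" "par w = r" "r \<noteq> w" by (auto simp: inner_def)
    have root: "r \<in> roots V par" using r flat by blast
    hence "{r, w} \<subseteq> {w \<in> V. par w = r}" using w by (auto simp: roots_def)
    hence "card {r, w} \<le> ?s r" using fin by (intro card_mono) auto
    thus "r \<in> {r \<in> roots V par. ?s r \<ge> 2}" using root w(3) by simp
  qed
  finally show "big_parts (flat_type V par) = card (inner V par)" .
  show "chromatic_sym (parent_graph V par) = chromatic_sym (star_forest (flat_type V par))"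
    by (rule chromatic_sym_flat_forest[OF F flat mset])
qed

lemma decreasing_list_unique:
  assumes "sorted_wrt (\<ge>) (xs :: nat list)" "sorted_wrt (\<ge>) ys" "mset xs = mset ys"
  shows "xs = ys"
proof -
  have "sort (rev xs) = rev xs" "sort (rev xs) = rev ys"
    using assms by (intro properties_for_sort; simp add: sorted_wrt_rev)+
  thus ?thesis by simp
qed

section \<open>Forests modulo differences of star forests\<close>

text \<open>The partition of \<open>n\<close> into \<open>l\<close> parts of which all but the first are \<open>1\<close>. It serves as the
  representative of its length, and the hooks other than \<open>[n]\<close> are the partitions that index no
  caterpillar of the basis.\<close>

definition hook :: "nat \<Rightarrow> nat \<Rightarrow> nat list" where
  "hook n l = (n - l + 1) # replicate (l - 1) 1"

definition star_diff :: "nat list \<Rightarrow> power_series" where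
  "star_diff p = chromatic_sym (star_forest p) - chromatic_sym (star_forest (hook (sum_list p) (length p)))"

definition star_diffs :: "nat \<Rightarrow> (nat list \<Rightarrow> bool) \<Rightarrow> power_series set" where
  "star_diffs n Q = star_diff ` {p \<in> partitions n. Q p}"

text \<open>The subtracted star forest depends on the number of roots only. In the relations between
  forests used below, the numbers of roots on the two sides agree as signed multisets, so that the
  subtracted terms cancel.\<close>

definition forest_diff :: "'a set \<Rightarrow> ('a \<Rightarrow> 'a) \<Rightarrow> power_series" where
  "forest_diff V par = chromatic_sym (parent_graph V par) -
     chromatic_sym (star_forest (hook (card V) (card (roots V par))))"

lemma span_star_diffs_mono:
  "x \<in> ps.span (star_diffs n Q) \<Longrightarrow> (\<And>p. Q p \<Longrightarrow> R p) \<Longrightarrow> x \<in> ps.span (star_diffs n R)"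
  using ps.span_mono[of "star_diffs n Q" "star_diffs n R"] by (auto simp: star_diffs_def)

lemma innerE:
  assumes "x \<in> inner V par"
  obtains w where "w \<in> V" "par w = x" "w \<noteq> x"
  using assms by (auto simp: inner_def)

lemma roots_cut: "v \<in> V \<Longrightarrow> roots V (par(v := v)) = insert v (roots V par)"
  by (auto simp: roots_def)

lemma inner_cut: "inner V (par(v := v)) \<subseteq> inner V par"
  by (auto simp: inner_def)

lemma roots_contract:
  assumes "rooted_forest V par" "v \<in> V" "par v \<noteq> v"
  shows "roots V (contract par v) = roots V par"
  using contract_nonroot_iff[OF assms] by (auto simp: roots_def)

lemma inner_contract:
  assumes "rooted_forest V par" "v \<in> V" "par v \<noteq> v"
  shows "inner V (contract par v) \<subseteq> inner V par - {v}"
proof -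
  have "contract par v w \<in> inner V par - {v}" if w: "w \<in> V" "contract par v w \<noteq> w" for w
  proof -
    have "par w \<noteq> w" using contract_nonroot_iff[OF assms w(1)] w(2) by simp
    thus ?thesis using assms w by (auto simp: contract_def inner_def)
  qed
  thus ?thesis by (auto simp: inner_def)
qed

lemma forest_diff_deletion_contraction:
  assumes "rooted_forest V par" "v \<in> V" "par v \<noteq> v"
  shows "forest_diff V par = forest_diff V (par(v := v)) + forest_diff V (contract par v)
    - forest_diff V ((contract par v)(v := v))"
  using deletion_near_contraction[OF assms]
  by (simp add: forest_diff_def roots_cut[OF assms(2)] roots_contract[OF assms] algebra_simps)

lemma partitions_sum: "p \<in> partitions n \<Longrightarrow> sum_list p = n"
  by (simp add: partitions_def)

text \<open>Contract the edge above a vertex that is neither a root nor a leaf, until none is left. Each of the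
  three resulting forests has fewer such vertices, no new vertex acquires a child, and the only new
  root is \<open>v\<close>, which already had a child. So both bounds are inherited. In a forest of depth one,
  they are the numbers of all components and of components with at least two vertices.\<close>

lemma forest_diff_in_span:
  assumes "rooted_forest V par"
  shows "forest_diff V par \<in> ps.span (star_diffs (card V)
    (\<lambda>p. length p \<le> card (inner V par \<union> roots V par) \<and> big_parts p \<le> card (inner V par)))"
  using assms
proof (induction "card (inner V par - roots V par)" arbitrary: par rule: less_induct)
  case less
  note F = less.prems
  have fin: "finite V" and "par ` V \<subseteq> V" using F by (auto simp: rooted_forest_def)
  hence inV: "inner V par \<subseteq> V" by (auto simp: inner_def)
  have finI: "finite (inner V par)" using inV fin by (rule finite_subset)
  have finU: "finite (inner V par \<union> roots V par)" using finI fin by (simp add: roots_def)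
  let ?Q = "\<lambda>p. length p \<le> card (inner V par \<union> roots V par) \<and> big_parts p \<le> card (inner V par)"
  show ?case
  proof (cases "inner V par \<subseteq> roots V par")
    case True
    note ft = flat_type[OF F True]
    have "inner V par \<union> roots V par = roots V par" using True by auto
    hence "star_diff (flat_type V par) \<in> star_diffs (card V) ?Q"
      using ft by (auto simp: star_diffs_def)
    moreover have "forest_diff V par = star_diff (flat_type V par)"
      using ft by (simp add: forest_diff_def star_diff_def partitions_sum)
    ultimately show ?thesis by (simp add: ps.span_base)
  next
    case False
    then obtain v where v: "v \<in> inner V par" "v \<notin> roots V par" by auto
    hence vV: "v \<in> V" "par v \<noteq> v" using inV by (auto simp: roots_def)
    have reduce: "forest_diff V q \<in> ps.span (star_diffs (card V) ?Q)"
      if q: "rooted_forest V q" "inner V q \<subseteq> inner V par" "inner V q - roots V q \<subseteq> inner V par - roots V par - {v}"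
        "roots V q \<subseteq> insert v (roots V par)" for q
    proof -
      have "card (inner V q - roots V q) < card (inner V par - roots V par)"
        using q(3) v finI by (intro psubset_card_mono) auto
      moreover have "inner V q \<union> roots V q \<subseteq> inner V par \<union> roots V par"
        using q v by auto
      hence "card (inner V q \<union> roots V q) \<le> card (inner V par \<union> roots V par)"
        by (rule card_mono[OF finU])
      moreover have "card (inner V q) \<le> card (inner V par)" by (rule card_mono[OF finI q(2)])
      ultimately show ?thesis
        by (intro span_star_diffs_mono[OF less.hyps[OF _ q(1)]]) auto
    qed
    note C = rooted_forest_contract[OF F vV(1)] and rc = roots_contract[OF F vV] and ic = inner_contract[OF F vV]
    have "forest_diff V (par(v := v)) \<in> ps.span (star_diffs (card V) ?Q)"
      by (rule reduce[OF rooted_forest_cut[OF F]]) (use inner_cut[of V par v] in \<open>auto simp: roots_cut vV\<close>)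
    moreover have "forest_diff V (contract par v) \<in> ps.span (star_diffs (card V) ?Q)"
      by (rule reduce[OF C]) (use rc ic in auto)
    moreover have "forest_diff V ((contract par v)(v := v)) \<in> ps.span (star_diffs (card V) ?Q)"
      by (rule reduce[OF rooted_forest_cut[OF C]])
         (use rc ic inner_cut[of V "contract par v" v] in \<open>auto simp: roots_cut vV\<close>)
    ultimately show ?thesis
      unfolding forest_diff_deletion_contraction[OF F vV] by (intro ps.span_add ps.span_diff)
  qed
qed

text \<open>The partitions that count as smaller than one with \<open>L\<close> parts, \<open>J\<close> of them at least \<open>2\<close>.\<close>

definition below :: "nat \<Rightarrow> nat \<Rightarrow> nat list \<Rightarrow> bool" where
  "below L J p \<longleftrightarrow> length p < L \<or> length p \<le> L \<and> big_parts p < J"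

lemma forest_diff_short:
  assumes F: "rooted_forest V par" and sub: "inner V par \<union> roots V par \<subseteq> U - {u}" "u \<in> U"
    and fin: "finite U" "card U \<le> L"
  shows "forest_diff V par \<in> ps.span (star_diffs (card V) (below L J))"
proof -
  have "inner V par \<union> roots V par \<subset> U" using sub by blast
  hence "card (inner V par \<union> roots V par) < card U" by (rule psubset_card_mono[OF fin(1)])
  thus ?thesis using forest_diff_in_span[OF F]
    by (elim span_star_diffs_mono) (use fin(2) in \<open>auto simp: below_def\<close>)
qed

lemma forest_diff_few:
  assumes F: "rooted_forest V par" and sub: "inner V par \<union> roots V par \<subseteq> U" "inner V par \<subseteq> I - {u}" "u \<in> I"
    and fin: "finite U" "card U \<le> L" "finite I" "card I \<le> J"
  shows "forest_diff V par \<in> ps.span (star_diffs (card V) (below L J))"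
proof -
  have "inner V par \<subset> I" using sub by blast
  hence "card (inner V par) < card I" by (rule psubset_card_mono[OF fin(3)])
  moreover have "card (inner V par \<union> roots V par) \<le> card U" by (rule card_mono[OF fin(1) sub(1)])
  ultimately show ?thesis using forest_diff_in_span[OF F]
    by (elim span_star_diffs_mono) (use fin in \<open>auto simp: below_def\<close>)
qed

text \<open>Among the three terms of the deletion-contraction at \<open>v\<close>, the contraction turns \<open>v\<close> into a leaf and
  so produces only partitions shorter than \<open>L\<close>; its split form makes \<open>v\<close> an isolated root and loses one
  vertex with children, hence produces fewer than \<open>J\<close> large parts. Only the deletion survives. The
  child outside \<open>S\<close> guarantees that a vertex of \<open>S\<close> still has a child when the others have been cut.\<close>

lemma forest_diff_cut_set:
  assumes "finite S" "rooted_forest V par" "S \<subseteq> V"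
    and "\<And>v. v \<in> S \<Longrightarrow> par v \<noteq> v"
    and "\<And>v. v \<in> S \<Longrightarrow> v \<in> inner V par"
    and "inner V par \<union> roots V par \<subseteq> U" "finite U" "card U \<le> L"
    and "inner V par \<subseteq> I" "finite I" "card I \<le> J"
    and "\<And>v. v \<in> S \<Longrightarrow> \<exists>w\<in>V - S. par w = v"
  shows "forest_diff V par - forest_diff V (\<lambda>w. if w \<in> S then w else par w)
    \<in> ps.span (star_diffs (card V) (below L J))"
  using assms
proof (induction S arbitrary: par rule: finite_induct)
  case empty
  show ?case by (simp only: empty_iff if_False diff_self ps.span_zero)
next
  case (insert v S)
  note F = insert.prems(1)
  have v: "v \<in> V" "par v \<noteq> v" "v \<in> inner V par" using insert.prems by auto
  let ?par = "par(v := v)"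
  note C = rooted_forest_contract[OF F v(1)] and rc = roots_contract[OF F v(1,2)] and ic = inner_contract[OF F v(1,2)]
  have child: "\<exists>x\<in>V - S. ?par x = w" if w: "w \<in> S" for w
  proof -
    obtain x where x: "x \<in> V - insert v S" "par x = w" using insert.prems(11)[of w] w by auto
    thus ?thesis by (intro bexI[of _ x]) auto
  qed
  have w_inner: "w \<in> inner V ?par" if w: "w \<in> S" for w
  proof -
    obtain x where x: "x \<in> V - S" "?par x = w" using child[OF w] by blast
    moreover have "x \<noteq> w" using x w by auto
    ultimately show ?thesis by (auto simp: inner_def)
  qed
  have "forest_diff V ?par - forest_diff V (\<lambda>w. if w \<in> S then w else ?par w)
      \<in> ps.span (star_diffs (card V) (below L J))"
  proof (rule insert.IH)
    show "inner V ?par \<union> roots V ?par \<subseteq> U"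
      using inner_cut[of V par v] roots_cut[OF v(1), of par] insert.prems(5) v(3) by auto
    show "inner V ?par \<subseteq> I" using inner_cut[of V par v] insert.prems(8) by auto
    show "?par w \<noteq> w" if "w \<in> S" for w using that insert.prems(3)[of w] insert.hyps by auto
    show "rooted_forest V ?par" by (rule rooted_forest_cut[OF F])
    show "w \<in> inner V ?par" "\<exists>x\<in>V - S. ?par x = w" if "w \<in> S" for w
      by (rule w_inner[OF that] child[OF that])+
  qed (use insert.prems in auto)
  moreover have "(\<lambda>w. if w \<in> S then w else ?par w) = (\<lambda>w. if w \<in> insert v S then w else par w)"
    by auto
  moreover have "forest_diff V (contract par v) \<in> ps.span (star_diffs (card V) (below L J))"
    by (rule forest_diff_short[OF C, of U v]) (use rc ic v insert.prems in \<open>auto simp: roots_def\<close>)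
  moreover have "forest_diff V ((contract par v)(v := v)) \<in> ps.span (star_diffs (card V) (below L J))"
    by (rule forest_diff_few[OF rooted_forest_cut[OF C], of v U I v])
       (use rc ic inner_cut[of V "contract par v" v] roots_cut[OF v(1), of "contract par v"] v insert.prems in auto)
  ultimately have "(forest_diff V ?par - forest_diff V (\<lambda>w. if w \<in> insert v S then w else par w))
     + (forest_diff V (contract par v) - forest_diff V ((contract par v)(v := v)))
     \<in> ps.span (star_diffs (card V) (below L J))"
    by (simp only: ps.span_add ps.span_diff)
  moreover have "a + b - c - d = (a - d) + (b - c)" for a b c d :: power_series
    by (simp add: algebra_simps)
  ultimately show ?case unfolding forest_diff_deletion_contraction[OF F v(1,2)] by (simp only:)
qed

text \<open>In the relation of \<open>pendant_exchange\<close>, both the deletion and the contraction make \<open>p\<close> a leaf, so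
  that they yield only partitions shorter than \<open>L\<close>. What remains is the forest in which \<open>p\<close> is split off,
  with a minus sign.\<close>

lemma forest_diff_pendant:
  assumes F: "rooted_forest V par" and v: "v \<in> V" "par v = p" "p \<noteq> v" "par p \<noteq> p" "v \<in> inner V par"
    and only: "\<And>w. w \<in> V \<Longrightarrow> par w = p \<Longrightarrow> w = v"
    and U: "inner V par \<union> roots V par \<subseteq> U" "finite U" "card U \<le> L"
  shows "rooted_forest V (par(v := par p, p := p))"
    and "forest_diff V par + forest_diff V (par(v := par p, p := p))
      \<in> ps.span (star_diffs (card V) (below L J))"
proof -
  note ex = pendant_exchange[OF F v(1-4) only, simplified]
  have pV: "p \<in> V" using F v by (auto simp: rooted_forest_def)
  have p_inner: "p \<in> inner V par" using v by (auto simp: inner_def)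
  have ppV: "par p \<in> inner V par" using pV v by (auto simp: inner_def)
  have ppv: "par p \<noteq> v"
  proof
    assume "par p = v"
    moreover obtain rk where rk: "\<And>v. v \<in> V \<Longrightarrow> par v \<noteq> v \<Longrightarrow> rk (par v) < (rk v :: nat)"
      using F by (rule rooted_forestE) blast
    ultimately show False using rk[OF v(1)] rk[OF pV] v by auto
  qed
  show "rooted_forest V (par(v := par p, p := p))"
    using rooted_forest_cut[OF ex(1), of p] by simp
  have r1: "roots V (par(v := par p, p := v)) = roots V par"
    using v ppv pV by (auto simp: roots_def)
  have r2: "roots V (par(v := par p, p := p)) = insert p (roots V par)"
    using v ppv pV by (auto simp: roots_def)
  have r3: "p \<notin> roots V par" "v \<notin> roots V par" using v by (auto simp: roots_def)
  have "forest_diff V (par(v := v)) \<in> ps.span (star_diffs (card V) (below L J))"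
  proof (rule forest_diff_short[OF rooted_forest_cut[OF F], of _ U p])
    have "p \<notin> inner V (par(v := v))" using only v(3) by (auto simp: inner_def split: if_splits)
    thus "inner V (par(v := v)) \<union> roots V (par(v := v)) \<subseteq> U - {p}"
      using inner_cut[of V par v] roots_cut[OF v(1), of par] U(1) v(3,5) r3 by auto
  qed (use U p_inner in auto)
  moreover have "forest_diff V (par(v := par p, p := v)) \<in> ps.span (star_diffs (card V) (below L J))"
  proof (rule forest_diff_short[OF ex(1), of U p])
    have "p \<notin> inner V (par(v := par p, p := v))"
    proof
      assume "p \<in> inner V (par(v := par p, p := v))"
      then obtain w where w: "w \<in> V" "(par(v := par p, p := v)) w = p" "w \<noteq> p"
        by (rule innerE)
      thus False using only[OF w(1)] v(3,4) by (cases "w = v") auto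
    qed
    moreover have "inner V (par(v := par p, p := v)) \<subseteq> inner V par"
    proof
      fix x assume "x \<in> inner V (par(v := par p, p := v))"
      then obtain w where w: "w \<in> V" "(par(v := par p, p := v)) w = x" "w \<noteq> x"
        by (rule innerE)
      have "par w \<in> inner V par" if "w \<noteq> v" "w \<noteq> p"
        using that w by (auto simp: inner_def)
      thus "x \<in> inner V par"
        unfolding w(2)[symmetric] using ppV v(3,5) by simp
    qed
    ultimately show "inner V (par(v := par p, p := v)) \<union> roots V (par(v := par p, p := v)) \<subseteq> U - {p}"
      using r1 r3 U(1) by auto
  qed (use U p_inner in auto)
  moreover have "forest_diff V par + forest_diff V (par(v := par p, p := p)) =
     forest_diff V (par(v := v)) + forest_diff V (par(v := par p, p := v))"
  proof -
    have c: "card (insert p (roots V par)) = card (insert v (roots V par))"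
      using r3 F by (auto simp: rooted_forest_def roots_def)
    show ?thesis unfolding forest_diff_def r1 r2 roots_cut[OF v(1)] c ex(2) by (simp add: algebra_simps)
  qed
  ultimately show "forest_diff V par + forest_diff V (par(v := par p, p := p))
      \<in> ps.span (star_diffs (card V) (below L J))" by (simp add: ps.span_add)
qed

section \<open>Caterpillars\<close>

lemma cells_Sigma: "cells \<alpha> = Sigma {..<length \<alpha>} (\<lambda>i. {..<\<alpha> ! i})"
  by (auto simp: cells_def)

lemma card_cells: "card (cells \<alpha>) = sum_list \<alpha>"
  by (simp add: cells_Sigma sum_list_sum_nth atLeast0LessThan)

lemma roots_star_par:
  assumes "\<forall>k\<in>set \<alpha>. k \<ge> 1"
  shows "roots (cells \<alpha>) (star_par nx) = (\<lambda>i. (i, 0)) ` {i. i < length \<alpha> \<and> nx i = i}"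
  using assms by (auto simp: roots_def star_par_def cells_def Suc_le_eq split: if_splits)

lemma chromatic_sym_star_forest_mset:
  assumes pos: "\<forall>k\<in>set \<alpha>. k \<ge> 1" and eq: "mset \<mu> = mset \<alpha>"
  shows "chromatic_sym (star_forest \<mu>) = chromatic_sym (star_forest \<alpha>)"
proof -
  let ?par = "star_par (\<lambda>i. i)"
  have roots: "roots (cells \<alpha>) ?par = (\<lambda>i. (i, 0)) ` {..<length \<alpha>}"
    using roots_star_par[OF pos] by (auto simp: lessThan_def)
  have size: "card {w \<in> cells \<alpha>. ?par w = (i, 0)} = \<alpha> ! i" if "i < length \<alpha>" for i
  proof -
    have "{w \<in> cells \<alpha>. ?par w = (i, 0)} = Pair i ` {..<\<alpha> ! i}"
      using that by (auto simp: cells_def star_par_def split: if_splits)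
    thus ?thesis by (simp add: card_image inj_on_def)
  qed
  have "image_mset (\<lambda>r. card {w \<in> cells \<alpha>. ?par w = r}) (mset_set (roots (cells \<alpha>) ?par)) =
    image_mset (\<lambda>i. card {w \<in> cells \<alpha>. ?par w = (i, 0)}) (mset_set {..<length \<alpha>})"
    unfolding roots by (subst image_mset_mset_set[symmetric]) (auto simp: inj_on_def image_mset.compositionality o_def)
  also have "\<dots> = image_mset ((!) \<alpha>) (mset_set {..<length \<alpha>})"
    by (rule image_mset_cong) (simp add: size)
  also have "\<dots> = mset (map ((!) \<alpha>) [0..<length \<alpha>])"
    by (simp add: atLeast0LessThan del: map_nth)
  also have "\<dots> = mset \<mu>" by (simp add: map_nth eq)
  finally have "chromatic_sym (parent_graph (cells \<alpha>) ?par) = chromatic_sym (star_forest \<mu>)"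
    by (intro chromatic_sym_flat_forest rooted_forest_star_par pos)
       (auto simp: inner_def roots_def star_par_def cells_def split: if_splits)
  thus ?thesis by (simp add: star_forest_eq)
qed

definition spine_next :: "nat \<Rightarrow> nat \<Rightarrow> nat" where
  "spine_next l i = (if Suc i < l then Suc i else i)"

lemma caterpillar_eq:
  assumes pos: "\<forall>k\<in>set \<alpha>. k \<ge> 1"
  shows "caterpillar \<alpha> = parent_graph (cells \<alpha>) (star_par (spine_next (length \<alpha>)))"
proof -
  let ?par = "star_par (spine_next (length \<alpha>))"
  have "edges (caterpillar \<alpha>) = {{v, ?par v} | v. v \<in> cells \<alpha> \<and> ?par v \<noteq> v}"
  proof (intro equalityI subsetI)
    fix e assume "e \<in> edges (caterpillar \<alpha>)"
    then consider i where "e = {(i, 0), (Suc i, 0)}" "Suc i < length \<alpha>"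
      | i j where "e = {(i, 0), (i, j)}" "i < length \<alpha>" "1 \<le> j" "j < \<alpha> ! i"
      unfolding caterpillar_def by auto
    hence "\<exists>v. e = {v, ?par v} \<and> v \<in> cells \<alpha> \<and> ?par v \<noteq> v"
    proof cases
      case (1 i)
      thus ?thesis using pos
        by (intro exI[of _ "(i, 0)"]) (auto simp: star_par_def cells_def spine_next_def Suc_le_eq)
    next
      case (2 i j)
      thus ?thesis
        by (intro exI[of _ "(i, j)"]) (auto simp: star_par_def cells_def)
    qed
    thus "e \<in> {{v, ?par v} | v. v \<in> cells \<alpha> \<and> ?par v \<noteq> v}" by blast
  next
    fix e assume "e \<in> {{v, ?par v} | v. v \<in> cells \<alpha> \<and> ?par v \<noteq> v}"
    then obtain i j where ij: "e = {(i, j), ?par (i, j)}" "(i, j) \<in> cells \<alpha>" "?par (i, j) \<noteq> (i, j)"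
      by auto
    show "e \<in> edges (caterpillar \<alpha>)"
    proof (cases "j = 0")
      case True
      hence "e = {(i, 0), (Suc i, 0)} \<and> Suc i < length \<alpha>"
        using ij by (auto simp: star_par_def spine_next_def split: if_splits)
      thus ?thesis unfolding caterpillar_def by auto
    next
      case False
      hence "e = {(i, 0), (i, j)} \<and> i < length \<alpha> \<and> 1 \<le> j \<and> j < \<alpha> ! i"
        using ij by (auto simp: star_par_def cells_def)
      thus ?thesis unfolding caterpillar_def snd_conv by blast
    qed
  qed
  thus ?thesis by (intro prod_eqI) (auto simp: caterpillar_def parent_graph_def cells_def)
qed

lemma caterpillar_forest:
  assumes pos: "\<forall>k\<in>set \<alpha>. k \<ge> 1" and "\<alpha> \<noteq> []"
  shows "rooted_forest (cells \<alpha>) (star_par (spine_next (length \<alpha>)))"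
    and "card (roots (cells \<alpha>) (star_par (spine_next (length \<alpha>)))) = 1"
proof -
  show "rooted_forest (cells \<alpha>) (star_par (spine_next (length \<alpha>)))"
    by (rule rooted_forest_star_par[OF pos]) (auto simp: spine_next_def)
  have "{i. i < length \<alpha> \<and> spine_next (length \<alpha>) i = i} = {length \<alpha> - 1}"
    using assms(2) by (auto simp: spine_next_def split: if_splits)
  thus "card (roots (cells \<alpha>) (star_par (spine_next (length \<alpha>)))) = 1"
    by (simp add: roots_star_par[OF pos])
qed

lemma nth_ge2_iff:
  "sorted_wrt (\<ge>) p \<Longrightarrow> i < length p \<Longrightarrow> p ! i \<ge> 2 \<longleftrightarrow> i < big_parts p"
proof (induction p arbitrary: i)
  case (Cons x p)
  show ?case
  proof (cases "x \<ge> 2")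
    case True
    thus ?thesis using Cons by (cases i) (auto simp: big_parts_def)
  next
    case False
    hence "\<forall>k\<in>set (x # p). \<not> k \<ge> 2" using Cons.prems(1) by fastforce
    moreover from this have "big_parts (x # p) = 0" by (auto simp: big_parts_def filter_empty_conv)
    ultimately show ?thesis using Cons.prems(2) nth_mem by (metis not_less0)
  qed
qed simp

lemma star_par_upd: "star_par (nx(i := x)) = (star_par nx)((i, 0) := (x, 0))"
  by (auto simp: star_par_def fun_eq_iff)

text \<open>Put \<open>\<alpha>\<close> for the partition with its largest part moved to the end. The parts of \<open>\<alpha>\<close> at least \<open>2\<close> are
  those at positions \<open>0, \<dots>, c\<close> and the last one; between them sit \<open>s\<close> ones, that is, spine vertices
  without leaves. These are split off one by one, each time changing the sign modulo \<open>below\<close>; then the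
  edges above the centres \<open>0, \<dots>, c\<close> are cut, and the star forest of \<open>p\<close> remains.\<close>

lemma star_diff_from_caterpillar:
  assumes p: "p \<in> partitions n" and len: "length p \<ge> 2" and p1: "p ! 1 \<ge> 2"
    and W: "star_diffs n (below (length p) (big_parts p)) \<subseteq> ps.span B"
    and cat: "chromatic_sym (caterpillar (tl p @ [hd p])) - chromatic_sym (star_forest [n]) \<in> ps.span B"
  shows "star_diff p \<in> ps.span B"
proof -
  define \<alpha> where "\<alpha> = tl p @ [hd p]"
  define l where "l = length p"
  define r where "r = big_parts p"
  define c where "c = r - 2"
  define s where "s = l - 2 - c"
  have ne: "p \<noteq> []" using len by auto
  have dec: "sorted_wrt (\<ge>) p" and pos_p: "\<forall>k\<in>set p. k \<ge> 1" and sum_p: "sum_list p = n"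
    using p by (auto simp: partitions_def)
  have mset: "mset \<alpha> = mset p" using ne by (cases p) (auto simp: \<alpha>_def)
  have set: "set \<alpha> = set p" using mset by (rule mset_eq_setD)
  have pos: "\<forall>k\<in>set \<alpha>. k \<ge> 1" using set pos_p by simp
  have l: "length \<alpha> = l" using mset_eq_length[OF mset] by (simp add: l_def)
  have n: "card (cells \<alpha>) = n" using sum_p mset by (metis card_cells sum_mset_sum_list)
  have "1 < r" using nth_ge2_iff[OF dec, of 1] p1 len by (simp add: r_def)
  have "r \<le> l" by (simp add: r_def l_def big_parts_def)
  have lens: "c + s + 2 = l" "c + 2 = r" using \<open>1 < r\<close> \<open>r \<le> l\<close> by (auto simp: c_def s_def)
  have \<alpha>_nth: "\<alpha> ! i = (if Suc i < l then p ! Suc i else p ! 0)" if "i < l" for i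
    using that ne by (auto simp: \<alpha>_def nth_append l_def nth_tl hd_conv_nth)
  have big: "\<alpha> ! i \<ge> 2 \<longleftrightarrow> i \<le> c \<or> i = Suc (c + s)" if "i < l" for i
    using nth_ge2_iff[OF dec, of "if Suc i < l then Suc i else 0"] that \<alpha>_nth[OF that] lens ne
    by (auto simp: l_def r_def split: if_splits)
  have pos': "\<alpha> ! i \<ge> 1" if "i < l" for i using pos that l by auto
  \<comment> \<open>After \<open>k\<close> steps the ones at positions \<open>c + 1, \<dots>, c + k\<close> are isolated, and the spine jumps over them.\<close>
  define nx where "nx = (\<lambda>k i. if i = c then c + k + 1 else if c < i \<and> i \<le> c + k then i
    else spine_next l i)"
  define F where "F = (\<lambda>k. star_par (nx k))"
  \<comment> \<open>Only centres are roots or have children, which bounds the length of all partitions that occur by \<open>l\<close>.\<close>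
  define U where "U = (\<lambda>i. (i, 0 :: nat)) ` {..<l}"
  have U: "finite U" "card U \<le> l" by (auto simp: U_def intro: card_image_le[of "{..<l}", simplified])
  have forest: "rooted_forest (cells \<alpha>) (F k)" if "k \<le> s" for k
    unfolding F_def using that lens
    by (intro rooted_forest_star_par pos) (auto simp: nx_def spine_next_def l)
  have subU: "inner (cells \<alpha>) (F k) \<union> roots (cells \<alpha>) (F k) \<subseteq> U" if "k \<le> s" for k
  proof -
    have "F k v \<in> U" if "v \<in> cells \<alpha>" for v
      using that \<open>k \<le> s\<close> lens l
      by (cases v) (auto simp: F_def star_par_def U_def nx_def spine_next_def cells_def)
    thus ?thesis by (auto simp: inner_def roots_def) metis
  qed
  let ?E = "star_diffs n (below l r)"
  have span: "ps.span ?E \<subseteq> ps.span B"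
    using W ps.span_minimal[OF _ ps.subspace_span] by (simp add: l_def r_def)
  have "forest_diff (cells \<alpha>) (F k) \<in> ps.span B" if "k \<le> s" for k
    using that
  proof (induction k)
    case 0
    have "F 0 = star_par (spine_next (length \<alpha>))"
      using lens by (auto simp: F_def nx_def fun_eq_iff star_par_def spine_next_def l)
    moreover have "\<alpha> \<noteq> []" by (simp add: \<alpha>_def)
    note caterpillar_forest(2)[OF pos this]
    moreover have "n \<ge> 1" using elem_le_sum_list[of 1 p] p1 len sum_p by simp
    hence "hook n 1 = [n]" by (simp add: hook_def)
    ultimately have "forest_diff (cells \<alpha>) (F 0) =
        chromatic_sym (caterpillar \<alpha>) - chromatic_sym (star_forest [n])"
      by (simp only: forest_diff_def caterpillar_eq[OF pos] n)
    thus ?case using cat by (simp only: \<alpha>_def)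
  next
    case (Suc k)
    let ?v = "(c, 0::nat)" and ?p = "(c + k + 1, 0::nat)"
    have k: "k < s" "c + k + 2 < l" using Suc.prems lens by auto
    have pp: "F k ?p = (c + k + 2, 0)" using k by (simp add: F_def star_par_def nx_def spine_next_def)
    have one: "\<alpha> ! (c + k + 1) = 1"
      using big[of "c + k + 1"] pos'[of "c + k + 1"] k lens by simp
    have Fc: "(F k)(?v := F k ?p, ?p := ?p) = F (Suc k)"
    proof -
      have "F (Suc k) = star_par ((nx k)(c := c + k + 2, c + k + 1 := c + k + 1))"
        unfolding F_def by (rule arg_cong[where f = star_par]) (auto simp: nx_def fun_eq_iff)
      thus ?thesis unfolding star_par_upd pp by (simp add: F_def)
    qed
    have "forest_diff (cells \<alpha>) (F k) + forest_diff (cells \<alpha>) ((F k)(?v := F k ?p, ?p := ?p))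
        \<in> ps.span (star_diffs (card (cells \<alpha>)) (below l r))"
    proof (rule forest_diff_pendant(2)[where U = U])
      show "rooted_forest (cells \<alpha>) (F k)" using forest k by simp
      show "?v \<in> cells \<alpha>" using pos'[of c] k by (simp add: cells_def l)
      show "F k ?v = ?p" "?p \<noteq> ?v" "F k ?p \<noteq> ?p"
        using pp by (simp_all add: F_def star_par_def nx_def)
      have "(c, 1) \<in> cells \<alpha> \<and> F k (c, 1) = ?v \<and> (c, 1) \<noteq> ?v"
        using big[of c] k by (simp add: cells_def l F_def star_par_def)
      thus "?v \<in> inner (cells \<alpha>) (F k)" by (force simp: inner_def)
      show "w = ?v" if w: "w \<in> cells \<alpha>" "F k w = ?p" for w
      proof -
        obtain i j where [simp]: "w = (i, j)" by force
        have "j = 0"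
          using w one by (cases "j = 0") (auto simp: F_def star_par_def cells_def)
        moreover from this have "nx k i = c + k + 1" using w by (simp add: F_def star_par_def)
        hence "i = c" using k by (auto simp: nx_def spine_next_def split: if_splits)
        ultimately show ?thesis by simp
      qed
      show "inner (cells \<alpha>) (F k) \<union> roots (cells \<alpha>) (F k) \<subseteq> U" using subU k by simp
    qed (use U in auto)
    hence "forest_diff (cells \<alpha>) (F k) + forest_diff (cells \<alpha>) (F (Suc k)) \<in> ps.span B"
      using span unfolding Fc n by blast
    from ps.span_diff[OF this Suc.IH] k show ?case by simp
  qed
  hence last: "forest_diff (cells \<alpha>) (F s) \<in> ps.span B" by simp
  define S where "S = (\<lambda>i. (i, 0 :: nat)) ` {..c}"
  \<comment> \<open>With all ones isolated, exactly \<open>r\<close> centres have children: those in \<open>S\<close> and the last one.\<close>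
  define I where "I = insert (c + s + 1, 0) S"
  have I: "finite I" "card I \<le> r"
  proof -
    have "card S \<le> c + 1" unfolding S_def using card_image_le[of "{..c}" "\<lambda>i. (i, 0)"] by simp
    thus "card I \<le> r" unfolding I_def using lens card_insert_le_m1
      by (metis S_def Suc_eq_plus1 add_2_eq_Suc' card_insert_if finite_atMost finite_imageI le_SucI not_less_eq_eq)
  qed (simp add: I_def S_def)
  have leaf: "(i, 1) \<in> cells \<alpha> - S \<and> F s (i, 1) = (i, 0)" if "i \<le> c" for i
    using that big[of i] lens by (auto simp: cells_def l S_def F_def star_par_def)
  have "forest_diff (cells \<alpha>) (F s) - forest_diff (cells \<alpha>) (\<lambda>w. if w \<in> S then w else F s w)
      \<in> ps.span (star_diffs (card (cells \<alpha>)) (below l r))"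
  proof (rule forest_diff_cut_set[where U = U and I = I])
    show "rooted_forest (cells \<alpha>) (F s)" by (rule forest) simp
    show "S \<subseteq> cells \<alpha>" using pos' lens by (auto simp: S_def cells_def l Suc_le_eq)
    show "F s v \<noteq> v" if "v \<in> S" for v
      using that lens by (auto simp: S_def F_def star_par_def nx_def spine_next_def split: if_splits)
    show "\<exists>w\<in>cells \<alpha> - S. F s w = v" if "v \<in> S" for v
      using that leaf by (auto simp: S_def)
    show "v \<in> inner (cells \<alpha>) (F s)" if "v \<in> S" for v
    proof -
      obtain i where "i \<le> c" "v = (i, 0)" using \<open>v \<in> S\<close> by (auto simp: S_def)
      thus ?thesis using leaf[of i] by (force simp: inner_def)
    qed
    show "inner (cells \<alpha>) (F s) \<union> roots (cells \<alpha>) (F s) \<subseteq> U" by (rule subU) simp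
    show "inner (cells \<alpha>) (F s) \<subseteq> I"
    proof
      fix x assume "x \<in> inner (cells \<alpha>) (F s)"
      then obtain w where w: "w \<in> cells \<alpha>" "F s w = x" "w \<noteq> x" by (rule innerE)
      obtain i j where ij: "w = (i, j)" by force
      show "x \<in> I"
      proof (cases "j = 0")
        case True
        thus ?thesis using w ij lens
          by (auto simp: F_def star_par_def nx_def spine_next_def I_def S_def cells_def l split: if_splits)
      next
        case False
        hence "i < l" "\<alpha> ! i \<ge> 2" using w(1) ij by (auto simp: cells_def l)
        thus ?thesis using big[of i] w(2) ij False by (auto simp: F_def star_par_def I_def S_def)
      qed
    qed
  qed (use U I in \<open>auto simp: S_def\<close>)
  hence d: "forest_diff (cells \<alpha>) (F s) - forest_diff (cells \<alpha>) (\<lambda>w. if w \<in> S then w else F s w) \<in> ps.span B"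
    using span unfolding n by blast
  have cut: "(\<lambda>w. if w \<in> S then w else F s w) = star_par (\<lambda>i. i)"
    using lens by (auto simp: fun_eq_iff S_def F_def star_par_def nx_def spine_next_def)
  have "roots (cells \<alpha>) (star_par (\<lambda>i. i)) = U"
    using roots_star_par[OF pos] by (auto simp: U_def l lessThan_def)
  moreover have "card U = l" by (simp add: U_def card_image inj_on_def)
  ultimately have "forest_diff (cells \<alpha>) (star_par (\<lambda>i. i)) = star_diff p"
    using chromatic_sym_star_forest_mset[OF pos mset[symmetric]]
    by (simp add: forest_diff_def star_diff_def n sum_p l_def flip: star_forest_eq)
  with ps.span_diff[OF last d] show ?thesis unfolding cut by simp
qed

section \<open>Trees are rooted forests with one root\<close>

lemma distinct_path_if_rtrancl:
  assumes "(a, b) \<in> R\<^sup>*"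
  shows "\<exists>xs. xs \<noteq> [] \<and> hd xs = a \<and> last xs = b \<and> distinct xs \<and> successively (\<lambda>x y. (x, y) \<in> R) xs"
  using assms
proof (induction rule: rtrancl_induct)
  case base
  show ?case by (intro exI[of _ "[a]"]) simp
next
  case (step b c)
  then obtain xs where xs: "xs \<noteq> []" "hd xs = a" "last xs = b" "distinct xs"
    "successively (\<lambda>x y. (x, y) \<in> R) xs" by blast
  show ?case
  proof (cases "c \<in> set xs")
    case True
    then obtain ys zs where split: "xs = (ys @ [c]) @ zs" using split_list by fastforce
    have "hd (ys @ [c]) = a" using xs(2) split by (cases ys) auto
    thus ?thesis using xs(4,5) unfolding split
      by (intro exI[of _ "ys @ [c]"]) (auto simp: successively_append_iff)
  next
    case False
    thus ?thesis using xs step.hyps(2)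
      by (intro exI[of _ "xs @ [c]"]) (auto simp: successively_append_iff)
  qed
qed

lemma connected_parent_graph:
  assumes F: "rooted_forest V par" and root: "card (roots V par) = 1"
  shows "connected_graph (parent_graph V par)"
proof -
  obtain r where r: "roots V par = {r}" using root by (auto simp: card_1_singleton_iff)
  obtain rk where V: "par ` V \<subseteq> V" and rk: "\<And>v. v \<in> V \<Longrightarrow> par v \<noteq> v \<Longrightarrow> rk (par v) < (rk v :: nat)"
    using F by (rule rooted_forestE) blast
  let ?R = "{(x, y). {x, y} \<in> edges (parent_graph V par)}"
  have up: "(v, r) \<in> ?R\<^sup>*" if "v \<in> V" for v
    using that
  proof (induction "rk v" arbitrary: v rule: less_induct)
    case less
    show ?case
    proof (cases "par v = v")
      case True
      thus ?thesis using less.prems r by (auto simp: roots_def)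
    next
      case False
      have "(v, par v) \<in> ?R" using less.prems False by (auto simp: parent_graph_def)
      moreover have "(par v, r) \<in> ?R\<^sup>*" using less rk False V by blast
      ultimately show ?thesis by (rule converse_rtrancl_into_rtrancl)
    qed
  qed
  have "sym ?R" by (auto simp: sym_def insert_commute)
  hence "(r, v) \<in> ?R\<^sup>*" if "v \<in> V" for v using up[OF that] by (meson sym_rtrancl symD)
  hence "\<forall>u\<in>V. \<forall>v\<in>V. (u, v) \<in> ?R\<^sup>*" using up by (blast intro: rtrancl_trans)
  moreover have "V \<noteq> {}" using r by (auto simp: roots_def)
  ultimately show ?thesis by (simp add: connected_graph_def parent_graph_def)
qed

text \<open>Both neighbours on the cycle of a vertex of maximal rank would have to be its parent.\<close>

lemma acyclic_parent_graph:
  assumes F: "rooted_forest V par"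
  shows "\<not> cycle_in (parent_graph V par) c"
proof
  assume c: "cycle_in (parent_graph V par) c"
  obtain rk where rk: "\<And>v. v \<in> V \<Longrightarrow> par v \<noteq> v \<Longrightarrow> rk (par v) < (rk v :: nat)"
    using F by (rule rooted_forestE) blast
  let ?n = "length c"
  have n: "?n \<ge> 3" and dist: "distinct c"
    and edge: "\<And>i. i < ?n \<Longrightarrow> {c ! i, c ! (Suc i mod ?n)} \<in> edges (parent_graph V par)"
    using c by (auto simp: cycle_in_def)
  have "finite (rk ` set c)" "rk ` set c \<noteq> {}" using n by auto
  then obtain x where x: "x \<in> set c" "\<And>y. y \<in> set c \<Longrightarrow> rk y \<le> rk x"
    using Max_in[of "rk ` set c"] Max_ge[of "rk ` set c"] by (metis (no_types, lifting) image_iff image_eqI)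
  have parent: "par x = u" if u: "u \<in> set c" "{x, u} \<in> edges (parent_graph V par)" for u
  proof -
    obtain v where v: "{x, u} = {v, par v}" "v \<in> V" "par v \<noteq> v"
      using u(2) by (auto simp: parent_graph_def)
    show ?thesis using x(2)[OF u(1)] rk[OF v(2,3)] v(1) by (auto simp: doubleton_eq_iff)
  qed
  obtain i where i: "i < ?n" "x = c ! i" using x(1) by (auto simp: in_set_conv_nth)
  define j where "j = (if i = 0 then ?n - 1 else i - 1)"
  have j: "j < ?n" "Suc j mod ?n = i" using i n by (auto simp: j_def)
  have k: "Suc i mod ?n < ?n" using n by (intro mod_less_divisor) auto
  have "par x = c ! (Suc i mod ?n)" using parent edge[OF i(1)] i(2) k by simp
  moreover have "par x = c ! j" using parent edge[OF j(1)] i(2) j by (simp add: insert_commute)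
  ultimately have "Suc i mod ?n = j" using dist j(1) k by (metis nth_eq_iff_index_eq)
  thus False using i n by (auto simp: j_def mod_Suc split: if_splits)
qed

lemma tree_parent_graph:
  assumes F: "rooted_forest V par" and root: "card (roots V par) = 1"
  shows "tree_graph (parent_graph V par)"
proof -
  have "simple_graph (parent_graph V par)"
    using F by (auto simp: simple_graph_def parent_graph_def rooted_forest_def card_2_iff)
  thus ?thesis using acyclic_parent_graph[OF F] connected_parent_graph[OF F root]
    by (simp add: tree_graph_def)
qed

text \<open>A rooted tree inside \<open>T\<close> with as many vertices as possible covers \<open>T\<close>: otherwise connectedness provides
  an edge that leaves it, whose outer end can be added as a child.\<close>

lemma maximal_subtree_spans:
  assumes T: "simple_graph T" "connected_graph T"
  obtains par where "rooted_forest (verts T) par" "card (roots (verts T) par) = 1"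
    "edges (parent_graph (verts T) par) \<subseteq> edges T"
proof -
  define P where "P = (\<lambda>k. \<exists>S par. S \<subseteq> verts T \<and> card S = k \<and> rooted_forest S par \<and>
    card (roots S par) = 1 \<and> edges (parent_graph S par) \<subseteq> edges T)"
  have fin: "finite (verts T)" using T by (simp add: simple_graph_def)
  obtain r where r: "r \<in> verts T" using T by (auto simp: connected_graph_def)
  have "P 1" unfolding P_def
    using r by (intro exI[of _ "{r}"] exI[of _ "\<lambda>x. x"])
      (auto simp: rooted_forest_def roots_def parent_graph_def)
  moreover have "\<forall>k. P k \<longrightarrow> k \<le> card (verts T)" using fin by (auto simp: P_def card_mono)
  ultimately obtain k where k: "P k" "\<And>k'. P k' \<Longrightarrow> k' \<le> k"
    using Greatest_le_nat GreatestI_nat by metis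
  then obtain S par where S: "S \<subseteq> verts T" "card S = k" "rooted_forest S par"
    "card (roots S par) = 1" "edges (parent_graph S par) \<subseteq> edges T" by (auto simp: P_def)
  have finS: "finite S" using S(1) fin by (rule finite_subset)
  have "S = verts T"
  proof (rule ccontr)
    assume "S \<noteq> verts T"
    then obtain w where w: "w \<in> verts T" "w \<notin> S" using S(1) by blast
    have "S \<noteq> {}" using S(4) by (auto simp: roots_def)
    then obtain u where u: "u \<in> S" by blast
    have "(u, w) \<in> {(x, y). {x, y} \<in> edges T}\<^sup>*"
      using T(2) u w S(1) by (auto simp: connected_graph_def)
    hence "w \<notin> S \<longrightarrow> (\<exists>x y. x \<in> S \<and> y \<notin> S \<and> {x, y} \<in> edges T)"
      by (induction rule: rtrancl_induct) (use u in auto)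
    then obtain x y where xy: "x \<in> S" "y \<notin> S" "{x, y} \<in> edges T" using w by blast
    have yT: "y \<in> verts T" using xy T(1) by (auto simp: simple_graph_def)
    obtain rk where V: "par ` S \<subseteq> S"
      and rk: "\<And>v. v \<in> S \<Longrightarrow> par v \<noteq> v \<Longrightarrow> rk (par v) < (rk v :: nat)"
      using S(3) by (rule rooted_forestE) blast
    have parS: "par v \<noteq> y" "v \<noteq> y" if "v \<in> S" for v using V xy that by auto
    let ?par = "par(y := x)"
    have "rooted_forest (insert y S) ?par"
    proof (rule rooted_forestI)
      fix v assume "v \<in> insert y S" "?par v \<noteq> v"
      thus "(rk(y := Suc (rk x))) (?par v) < (rk(y := Suc (rk x))) v"
        using rk[of v] parS[of v] xy by auto
    qed (use finS V xy in auto)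
    moreover have "roots (insert y S) ?par = roots S par"
      using parS xy by (auto simp: roots_def)
    moreover have "edges (parent_graph (insert y S) ?par) \<subseteq> edges T"
    proof
      fix e assume "e \<in> edges (parent_graph (insert y S) ?par)"
      then obtain v where v: "e = {v, ?par v}" "v \<in> insert y S" "?par v \<noteq> v"
        by (auto simp: parent_graph_def)
      show "e \<in> edges T"
      proof (cases "v = y")
        case True
        thus ?thesis using v xy by (simp add: insert_commute)
      next
        case False
        hence "e \<in> edges (parent_graph S par)" using v by (auto simp: parent_graph_def)
        thus ?thesis using S(5) by blast
      qed
    qed
    ultimately have "P (Suc k)" unfolding P_def
      using S xy yT finS by (intro exI[of _ "insert y S"] exI[of _ ?par]) simp
    thus False using k(2) by fastforce
  qed
  thus ?thesis using that S by blast
qed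

text \<open>An edge of \<open>T\<close> outside the spanning rooted tree would close the path between its ends to a cycle.\<close>

lemma tree_eq_parent_graph:
  assumes T: "tree_graph T"
  obtains par where "rooted_forest (verts T) par" "card (roots (verts T) par) = 1"
    "T = parent_graph (verts T) par"
proof -
  have simple: "simple_graph T" and conn: "connected_graph T" and acyc: "\<And>c. \<not> cycle_in T c"
    using T by (auto simp: tree_graph_def)
  obtain par where par: "rooted_forest (verts T) par" "card (roots (verts T) par) = 1"
    "edges (parent_graph (verts T) par) \<subseteq> edges T"
    by (rule maximal_subtree_spans[OF simple conn])
  let ?G = "parent_graph (verts T) par"
  have "edges T \<subseteq> edges ?G"
  proof (rule ccontr)
    assume "\<not> ?thesis"
    then obtain e where e: "e \<in> edges T" "e \<notin> edges ?G" by blast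
    then obtain a b where ab: "e = {a, b}" "a \<noteq> b" "a \<in> verts T" "b \<in> verts T"
      using simple by (fastforce simp: simple_graph_def card_2_iff)
    have "(a, b) \<in> {(x, y). {x, y} \<in> edges ?G}\<^sup>*"
      using connected_parent_graph[OF par(1,2)] ab by (simp add: connected_graph_def parent_graph_def)
    from distinct_path_if_rtrancl[OF this] obtain xs where xs: "xs \<noteq> []" "hd xs = a" "last xs = b"
      "distinct xs" "successively (\<lambda>x y. {x, y} \<in> edges ?G) xs" by auto
    have step: "{xs ! i, xs ! Suc i} \<in> edges ?G" if "Suc i < length xs" for i
      using xs(5) that by (simp add: successively_conv_nth)
    have ends: "xs ! 0 = a" "xs ! (length xs - 1) = b"
      using xs by (simp_all add: hd_conv_nth last_conv_nth)
    have "length xs \<noteq> 1" using ends ab(2) by auto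
    moreover have "length xs \<noteq> 2" using ends step[of 0] e(2) ab(1) by auto
    ultimately have "length xs \<ge> 3" using xs(1) by (cases "length xs") auto
    moreover have "{xs ! i, xs ! (Suc i mod length xs)} \<in> edges T" if i: "i < length xs" for i
    proof (cases "Suc i < length xs")
      case True
      thus ?thesis using step par(3) by auto
    next
      case False
      hence "i = length xs - 1" "Suc i = length xs" using i by auto
      thus ?thesis using e(1) ab(1) ends by (simp add: insert_commute)
    qed
    ultimately have "cycle_in T xs" using xs(4) by (simp add: cycle_in_def)
    thus False using acyc by blast
  qed
  hence "T = ?G" using par(3) by (intro prod_eqI) (auto simp: parent_graph_def)
  thus ?thesis using that par by blast
qed

lemma hook_1: "n \<ge> 1 \<Longrightarrow> hook n 1 = [n]"
  by (simp add: hook_def)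

lemma tree_diff_in_span:
  assumes T: "tree_graph T" and n: "card (verts T) = n" "n \<ge> 1"
  shows "chromatic_sym T - chromatic_sym (star_forest [n]) \<in> ps.span (star_diffs n (\<lambda>_. True))"
proof -
  obtain par where par: "rooted_forest (verts T) par" "card (roots (verts T) par) = 1"
    "T = parent_graph (verts T) par" by (rule tree_eq_parent_graph[OF T])
  have "chromatic_sym T - chromatic_sym (star_forest [n]) = forest_diff (verts T) par"
    unfolding forest_diff_def par(2) par(3)[symmetric] n(1) hook_1[OF n(2)] ..
  thus ?thesis
    using span_star_diffs_mono[OF forest_diff_in_span[OF par(1)], of "\<lambda>_. True"] n(1) by simp
qed

text \<open>The forest is transported along a numbering of its vertices, because the trees that define
  \<open>tree_space\<close> have natural numbers as vertices.\<close>

lemma chromatic_sym_in_tree_space: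
  fixes V :: "'a set"
  assumes F: "rooted_forest V par" and root: "card (roots V par) = 1"
  shows "chromatic_sym (parent_graph V par) \<in> tree_space (card V)"
proof -
  obtain rk where V: "finite V" "par ` V \<subseteq> V"
    and rk: "\<And>v. v \<in> V \<Longrightarrow> par v \<noteq> v \<Longrightarrow> rk (par v) < (rk v :: nat)"
    using F by (rule rooted_forestE) blast
  obtain f :: "'a \<Rightarrow> nat" where f: "bij_betw f V {..<card V}"
    using ex_bij_betw_finite_nat[OF V(1)] by (auto simp: atLeast0LessThan)
  let ?W = "{..<card V}" and ?g = "inv_into V f"
  define q where "q = f \<circ> par \<circ> ?g"
  have W: "f ` V = ?W" and inj: "inj_on f V" using f by (auto simp: bij_betw_def)
  have q: "q (f v) = f (par v)" if "v \<in> V" for v using that inj by (simp add: q_def)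
  have q_fix: "q (f v) = f v \<longleftrightarrow> par v = v" if "v \<in> V" for v
    using that V(2) inj by (auto simp: q inj_on_def)
  have F': "rooted_forest ?W q"
  proof (rule rooted_forestI)
    fix w assume "w \<in> ?W"
    then obtain v where v: "v \<in> V" "w = f v" using W by blast
    show "q w \<in> ?W" using v V(2) W q by auto
    assume "q w \<noteq> w"
    thus "(rk \<circ> ?g) (q w) < (rk \<circ> ?g) w"
      using v V(2) rk[of v] q_fix inj by (simp add: q image_subset_iff)
  qed simp
  have "roots ?W q = f ` roots V par" unfolding roots_def W[symmetric] using q_fix by auto
  moreover have "inj_on f (roots V par)" using inj by (rule inj_on_subset) (auto simp: roots_def)
  ultimately have "card (roots ?W q) = 1" using root by (simp add: card_image)
  hence "tree_graph (parent_graph ?W q)" by (rule tree_parent_graph[OF F'])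
  moreover have "card (verts (parent_graph ?W q)) = card V" by (simp add: parent_graph_def)
  ultimately have "chromatic_sym (parent_graph ?W q) \<in> tree_space (card V)"
    unfolding tree_space_def by (intro ps.span_base) blast
  thus ?thesis using chromatic_sym_forest_iso[OF F F' f q] by simp
qed

section \<open>Independence of power sums\<close>

abbreviation star_chrom :: "nat list \<Rightarrow> power_series" where
  "star_chrom p \<equiv> chromatic_sym (star_forest p)"

text \<open>Colourings that agree along an edge are all colourings minus those that differ along it. This
  trades the equalities for inequalities one at a time, and inequalities alone describe a forest of
  depth one.\<close>

lemma mixed_colour_count_in_span:
  assumes V: "finite V" and M: "finite M"
    and "N \<union> M \<subseteq> {v \<in> V. par v \<noteq> v}" and flat: "inner V par \<subseteq> roots V par"
  shows "colour_count V (\<lambda>\<kappa>. (\<forall>v\<in>N. \<kappa> v \<noteq> \<kappa> (par v)) \<and> (\<forall>v\<in>M. \<kappa> v = \<kappa> (par v)))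
    \<in> ps.span (star_chrom ` partitions (card V))"
  using M assms(3)
proof (induction M arbitrary: N rule: finite_induct)
  case empty
  let ?q = "\<lambda>v. if v \<in> N then par v else v"
  have N: "v \<in> V" "par v \<noteq> v" "par v \<notin> N" "par v \<in> V" if "v \<in> N" for v
  proof -
    show v: "v \<in> V" "par v \<noteq> v" using that empty by auto
    hence "par v \<in> roots V par" using flat by (auto simp: inner_def)
    thus "par v \<notin> N" "par v \<in> V" using empty by (auto simp: roots_def)
  qed
  have F: "rooted_forest V ?q"
    by (rule rooted_forestI[OF V, where rk = "\<lambda>v. if v \<in> N then 1 else 0"]) (use N in \<open>auto split: if_splits\<close>)
  have "inner V ?q \<subseteq> roots V ?q"
    using N by (auto simp: inner_def roots_def)
  note ft = flat_type[OF F this]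
  have "proper V ?q = (\<lambda>\<kappa>. (\<forall>v\<in>N. \<kappa> v \<noteq> \<kappa> (par v)) \<and> (\<forall>v\<in>{}. \<kappa> v = \<kappa> (par v)))"
    using N by (auto simp: proper_def fun_eq_iff)
  hence "colour_count V (\<lambda>\<kappa>. (\<forall>v\<in>N. \<kappa> v \<noteq> \<kappa> (par v)) \<and> (\<forall>v\<in>{}. \<kappa> v = \<kappa> (par v))) =
      star_chrom (flat_type V ?q)"
    using chromatic_sym_rooted_forest[OF F] ft(4) by (simp only:)
  moreover have "star_chrom (flat_type V ?q) \<in> ps.span (star_chrom ` partitions (card V))"
    using ft(1) by (intro ps.span_base imageI)
  ultimately show ?case by (simp only:)
next
  case (insert u M)
  let ?C = "\<lambda>N M. colour_count V (\<lambda>\<kappa>. (\<forall>v\<in>N. \<kappa> v \<noteq> \<kappa> (par v)) \<and> (\<forall>v\<in>M. \<kappa> v = \<kappa> (par v)))"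
  have "?C N M = ?C N (insert u M) + ?C (insert u N) M"
    using colour_count_split[OF V, where P = "\<lambda>\<kappa>. (\<forall>v\<in>N. \<kappa> v \<noteq> \<kappa> (par v)) \<and> (\<forall>v\<in>M. \<kappa> v = \<kappa> (par v))"
        and Q = "\<lambda>\<kappa>. \<kappa> u = \<kappa> (par u)"]
    by (simp add: conj_ac)
  hence "?C N (insert u M) = ?C N M - ?C (insert u N) M" by simp
  moreover have "?C N M \<in> ps.span (star_chrom ` partitions (card V))"
    by (rule insert.IH) (use insert.prems in auto)
  moreover have "?C (insert u N) M \<in> ps.span (star_chrom ` partitions (card V))"
    by (rule insert.IH) (use insert.prems in auto)
  ultimately show ?case by (simp only: ps.span_diff)
qed

text \<open>Colourings that are constant on every star: choosing one colour for each part \<open>k\<close> of \<open>p\<close> contributes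
  the \<open>k\<close>-th power of a variable, so this is the power sum symmetric function indexed by \<open>p\<close>.\<close>

definition power_sum :: "nat list \<Rightarrow> power_series" where
  "power_sum p = colour_count (cells p) (\<lambda>\<kappa>. \<forall>(i, j)\<in>cells p. \<kappa> (i, j) = \<kappa> (i, 0))"

text \<open>Variables are indexed from \<open>1\<close>, parts from \<open>0\<close>.\<close>

definition exponents :: "nat list \<Rightarrow> (nat \<Rightarrow>\<^sub>0 nat)" where
  "exponents p = (\<Sum>i<length p. Poly_Mapping.single (Suc i) (p ! i))"

lemma power_sum_in_span: "power_sum p \<in> ps.span (star_chrom ` partitions (sum_list p))"
proof -
  let ?par = "star_par (\<lambda>i. i)"
  let ?M = "{v \<in> cells p. ?par v \<noteq> v}"
  have "colour_count (cells p) (\<lambda>\<kappa>. (\<forall>v\<in>{}. \<kappa> v \<noteq> \<kappa> (?par v)) \<and> (\<forall>v\<in>?M. \<kappa> v = \<kappa> (?par v)))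
      \<in> ps.span (star_chrom ` partitions (card (cells p)))"
  proof (rule mixed_colour_count_in_span)
    show "inner (cells p) ?par \<subseteq> roots (cells p) ?par"
      by (auto simp: inner_def roots_def star_par_def cells_def split: if_splits)
  qed (use finite_cells in auto)
  moreover have "(\<lambda>\<kappa>. (\<forall>v\<in>{}. \<kappa> v \<noteq> \<kappa> (?par v)) \<and> (\<forall>v\<in>?M. \<kappa> v = (\<kappa> (?par v) :: nat))) =
    (\<lambda>\<kappa>. \<forall>(i, j)\<in>cells p. \<kappa> (i, j) = \<kappa> (i, 0))"
  proof (rule ext)
    fix \<kappa> :: "nat \<times> nat \<Rightarrow> nat"
    have "(\<forall>v\<in>?M. \<kappa> v = \<kappa> (?par v)) \<longleftrightarrow> (\<forall>v\<in>cells p. \<kappa> v = \<kappa> (?par v))"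
      by force
    moreover have "?par (i, j) = (i, 0)" for i j by (simp add: star_par_def)
    ultimately show "((\<forall>v\<in>{}. \<kappa> v \<noteq> \<kappa> (?par v)) \<and> (\<forall>v\<in>?M. \<kappa> v = \<kappa> (?par v))) =
      (\<forall>(i, j)\<in>cells p. \<kappa> (i, j) = \<kappa> (i, 0))" by auto
  qed
  ultimately show ?thesis unfolding power_sum_def card_cells by (simp only:)
qed

lemma monomial_of_star_colouring:
  assumes "\<And>i j. (i, j) \<in> cells p \<Longrightarrow> \<kappa> (i, j) = (g i :: nat)"
  shows "(\<Sum>v\<in>cells p. Poly_Mapping.single (\<kappa> v) (1::nat)) =
    (\<Sum>i<length p. Poly_Mapping.single (g i) (p ! i))"
proof -
  have single: "(\<Sum>j<m. Poly_Mapping.single k (1::nat)) = Poly_Mapping.single k m" for k :: nat and m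
  proof (induction m)
    case (Suc m)
    have "(\<Sum>j<Suc m. Poly_Mapping.single k (1::nat)) = Poly_Mapping.single k m + Poly_Mapping.single k 1"
      unfolding sum.lessThan_Suc Suc.IH ..
    thus ?case by (simp flip: single_add)
  qed simp
  have "(\<Sum>v\<in>cells p. Poly_Mapping.single (\<kappa> v) (1::nat)) =
    (\<Sum>i<length p. \<Sum>j<p ! i. Poly_Mapping.single (\<kappa> (i, j)) 1)"
    unfolding cells_Sigma by (subst sum.Sigma) auto
  also have "\<dots> = (\<Sum>i<length p. \<Sum>j<p ! i. Poly_Mapping.single (g i) 1)"
    by (intro sum.cong refl) (simp add: assms cells_def)
  finally show ?thesis by (simp only: single)
qed

lemma power_sum_exponents_self:
  assumes "p \<in> partitions n"
  shows "power_sum p (exponents p) \<noteq> 0"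
proof -
  let ?\<kappa> = "restrict (\<lambda>(i, j). Suc i) (cells p)"
  let ?S = "{\<kappa> \<in> cells p \<rightarrow>\<^sub>E {1..}. (\<forall>(i, j)\<in>cells p. \<kappa> (i, j) = \<kappa> (i, 0)) \<and>
    (\<Sum>v\<in>cells p. Poly_Mapping.single (\<kappa> v) (1::nat)) = exponents p}"
  have "(\<Sum>v\<in>cells p. Poly_Mapping.single (?\<kappa> v) (1::nat)) = exponents p"
    unfolding exponents_def by (rule monomial_of_star_colouring) simp
  moreover
  have "?\<kappa> (i, j) = ?\<kappa> (i, 0)" if "(i, j) \<in> cells p" for i j
    using that by (auto simp: cells_def)
  hence "\<forall>(i, j)\<in>cells p. ?\<kappa> (i, j) = ?\<kappa> (i, 0)" by blast
  moreover have "?\<kappa> \<in> cells p \<rightarrow>\<^sub>E {1..}" by auto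
  ultimately have "?\<kappa> \<in> ?S" by (intro CollectI conjI)
  hence "?S \<noteq> {}" by blast
  moreover have "finite ?S" by (rule finite_colourings[OF finite_cells])
  ultimately have "card ?S \<noteq> 0" using card_0_eq by blast
  thus ?thesis unfolding power_sum_def colour_count_def by (simp only: of_nat_eq_0_iff not_False_eq_True)
qed

text \<open>A colouring of the stars of \<open>p\<close> that yields the monomial of \<open>q\<close> groups the parts of \<open>p\<close> into blocks
  whose sums are the parts of \<open>q\<close>. So \<open>q\<close> is not longer than \<open>p\<close>, and for equal length every block is a
  single part.\<close>

lemma power_sum_triangular:
  assumes p: "p \<in> partitions n" and q: "q \<in> partitions n" and nz: "power_sum p (exponents q) \<noteq> 0"
  shows "p = q \<or> length q < length p"
proof (cases "length q < length p")
  case False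
  have pos: "\<And>i. i < length q \<Longrightarrow> q ! i \<ge> 1" using q by (simp add: partitions_def)
  have "{\<kappa> \<in> cells p \<rightarrow>\<^sub>E {1..}. (\<forall>(i, j)\<in>cells p. \<kappa> (i, j) = \<kappa> (i, 0)) \<and>
    (\<Sum>v\<in>cells p. Poly_Mapping.single (\<kappa> v) (1::nat)) = exponents q} \<noteq> {}"
    using nz unfolding power_sum_def colour_count_def by (metis card.empty of_nat_0)
  then obtain \<kappa> where \<kappa>: "\<And>i j. (i, j) \<in> cells p \<Longrightarrow> \<kappa> (i, j) = \<kappa> (i, 0 :: nat)"
    "(\<Sum>v\<in>cells p. Poly_Mapping.single (\<kappa> v) (1::nat)) = exponents q" by blast
  define g where "g = (\<lambda>i. \<kappa> (i, 0))"
  have "(\<Sum>i<length p. Poly_Mapping.single (g i) (p ! i)) = exponents q"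
    using monomial_of_star_colouring[of p \<kappa> g] \<kappa> by (simp add: g_def)
  hence "Poly_Mapping.lookup (\<Sum>i<length p. Poly_Mapping.single (g i) (p ! i)) c =
    Poly_Mapping.lookup (exponents q) c" for c by simp
  hence look: "(\<Sum>i<length p. p ! i when g i = c) = (\<Sum>i<length q. q ! i when Suc i = c)" for c
    by (simp add: exponents_def lookup_sum lookup_single)
  have qj: "(\<Sum>i<length p. p ! i when g i = Suc j) = q ! j" if "j < length q" for j
  proof -
    have "(\<Sum>i<length q. q ! i when Suc i = Suc j) = (\<Sum>i\<in>{j}. q ! i when Suc i = Suc j)"
      by (rule sum.mono_neutral_right) (use that in auto)
    thus ?thesis using look by simp
  qed
  have sub: "Suc ` {..<length q} \<subseteq> g ` {..<length p}"
  proof (rule ccontr)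
    assume "\<not> ?thesis"
    then obtain j where j: "j < length q" "Suc j \<notin> g ` {..<length p}" by auto
    have "g i \<noteq> Suc j" if "i < length p" for i using j(2) that by (metis imageI lessThan_iff)
    hence "(\<Sum>i<length p. p ! i when g i = Suc j) = 0" by simp
    thus False using qj[OF j(1)] pos[OF j(1)] by simp
  qed
  have "card (Suc ` {..<length q}) \<le> card (g ` {..<length p})" by (rule card_mono[OF _ sub]) simp
  moreover have "card (g ` {..<length p}) \<le> length p" using card_image_le[of "{..<length p}" g] by simp
  moreover have "card (Suc ` {..<length q}) = length q" by (simp add: card_image)
  ultimately have len: "length q = length p" and card: "card (g ` {..<length p}) = card {..<length p}"
    using False by auto
  have inj: "inj_on g {..<length p}" using card by (intro eq_card_imp_inj_on) auto
  have img: "Suc ` {..<length q} = g ` {..<length p}"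
    using sub card len by (intro card_subset_eq) (auto simp: card_image)
  \<comment> \<open>With equally many parts on both sides, \<open>h\<close> matches each part of \<open>p\<close> with an equal part of \<open>q\<close>.\<close>
  define h where "h = (\<lambda>i. g i - 1)"
  have g: "g i = Suc (h i)" "h i < length q" if "i < length p" for i
  proof -
    have "g i \<in> Suc ` {..<length q}" using that img by blast
    thus "g i = Suc (h i)" "h i < length q" by (auto simp: h_def)
  qed
  have ph: "p ! i = q ! h i" if "i < length p" for i
  proof -
    have "(\<Sum>k<length p. p ! k when g k = Suc (h i)) = (\<Sum>k\<in>{i}. p ! k when g k = Suc (h i))"
    proof (rule sum.mono_neutral_right)
      show "\<forall>k\<in>{..<length p} - {i}. (p ! k when g k = Suc (h i)) = 0"
      proof
        fix k assume k: "k \<in> {..<length p} - {i}"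
        hence "g k \<noteq> g i" using inj_onD[OF inj, of k i] that by auto
        thus "(p ! k when g k = Suc (h i)) = 0" using g(1)[OF that] by simp
      qed
    qed (use that in auto)
    thus ?thesis using qj[OF g(2)[OF that]] g(1)[OF that] by simp
  qed
  have inj_h: "inj_on h {..<length p}" 
  proof (rule inj_onI)
    fix i k assume "i \<in> {..<length p}" "k \<in> {..<length p}" "h i = h k"
    thus "i = k" using inj_onD[OF inj, of i k] g(1)[of i] g(1)[of k] by simp
  qed
  have "h ` {..<length p} = {..<length q}"
    using g inj_h len by (intro card_subset_eq) (auto simp: card_image)
  hence "image_mset ((!) q) (mset_set {..<length q}) = image_mset ((!) q) (image_mset h (mset_set {..<length p}))"
    by (simp add: image_mset_mset_set[OF inj_h])
  also have "\<dots> = image_mset ((!) p) (mset_set {..<length p})"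
    by (auto simp: image_mset.compositionality ph intro!: image_mset_cong)
  finally have "mset (map ((!) q) [0..<length q]) = mset (map ((!) p) [0..<length p])"
    by (simp add: atLeast0LessThan del: map_nth)
  hence "mset p = mset q" by (simp add: map_nth)
  thus ?thesis using p q decreasing_list_unique by (auto simp: partitions_def)
qed simp

lemma sum_series_apply: "(\<Sum>x\<in>A. f x :: power_series) m = (\<Sum>x\<in>A. f x m)"
  by (induction A rule: infinite_finite_induct) auto

text \<open>In a vanishing combination, look at the coefficient of the monomial of a longest partition \<open>q\<close> that
  occurs: by triangularity only \<open>power_sum q\<close> contributes to it.\<close>

lemma power_sums_independent:
  "inj_on power_sum (partitions n)" "ps.independent (power_sum ` partitions n)"
proof -
  show inj: "inj_on power_sum (partitions n)"
  proof (rule inj_onI)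
    fix p q assume pq: "p \<in> partitions n" "q \<in> partitions n" "power_sum p = power_sum q"
    thus "p = q"
      using power_sum_triangular[of p n q] power_sum_triangular[of q n p] power_sum_exponents_self
      by (metis less_asym)
  qed
  show "ps.independent (power_sum ` partitions n)"
  proof
    assume "ps.dependent (power_sum ` partitions n)"
    then obtain u where "\<exists>v\<in>power_sum ` partitions n. u v \<noteq> 0"
      and zero: "(\<Sum>v\<in>power_sum ` partitions n. ps_scale (u v) v) = 0"
      by (subst (asm) ps.dependent_finite) (auto simp: finite_partitions)
    hence "{p \<in> partitions n. u (power_sum p) \<noteq> 0} \<noteq> {}" by auto
    moreover have "finite {p \<in> partitions n. u (power_sum p) \<noteq> 0}" using finite_partitions by simp
    ultimately have "Max (length ` {p \<in> partitions n. u (power_sum p) \<noteq> 0})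
        \<in> length ` {p \<in> partitions n. u (power_sum p) \<noteq> 0}" by (intro Max_in) auto
    then obtain q where q: "q \<in> partitions n" "u (power_sum q) \<noteq> 0"
      and Max: "Max (length ` {p \<in> partitions n. u (power_sum p) \<noteq> 0}) = length q" by auto
    have longest: "length p \<le> length q" if "p \<in> partitions n" "u (power_sum p) \<noteq> 0" for p
      unfolding Max[symmetric] using that finite_partitions by (intro Max_ge) auto
    have "(\<Sum>p\<in>partitions n. ps_scale (u (power_sum p)) (power_sum p)) = 0"
      using zero by (simp add: sum.reindex[OF inj] del: zero_fun_def)
    hence "(\<Sum>p\<in>partitions n. ps_scale (u (power_sum p)) (power_sum p)) (exponents q) = 0" by simp
    hence "(\<Sum>p\<in>partitions n. u (power_sum p) * power_sum p (exponents q)) = 0"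
      by (simp add: sum_series_apply ps_scale_def)
    moreover have "(\<Sum>p\<in>partitions n. u (power_sum p) * power_sum p (exponents q)) =
      (\<Sum>p\<in>{q}. u (power_sum p) * power_sum p (exponents q))"
    proof (rule sum.mono_neutral_right)
      show "\<forall>p\<in>partitions n - {q}. u (power_sum p) * power_sum p (exponents q) = 0"
      proof
        fix p assume p: "p \<in> partitions n - {q}"
        hence "power_sum p (exponents q) = 0" if "u (power_sum p) \<noteq> 0"
          using power_sum_triangular[of p n q] longest[of p] q(1) that by (cases "power_sum p (exponents q) = 0") auto
        thus "u (power_sum p) * power_sum p (exponents q) = 0" by auto
      qed
    qed (use q finite_partitions in auto)
    ultimately show False using q power_sum_exponents_self by simp
  qed
qed

section \<open>The space spanned by trees\<close>

text \<open>Which partitions index a caterpillar of the basis.\<close>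

definition spine_condition :: "nat \<Rightarrow> nat list \<Rightarrow> bool" where
  "spine_condition n p \<longleftrightarrow> p = [n] \<or> length p \<ge> 2 \<and> p ! 1 \<ge> 2"

lemma caterpillar_basis_eq:
  "caterpillar_basis n =
    (\<lambda>p. chromatic_sym (caterpillar (tl p @ [hd p]))) ` {p \<in> partitions n. spine_condition n p}"
  by (auto simp: caterpillar_basis_def spine_condition_def)

lemma partition_length:
  assumes "p \<in> partitions n" "n \<ge> 1"
  shows "1 \<le> length p" "length p \<le> n"
proof -
  show "1 \<le> length p" using assms by (cases p) (auto simp: partitions_def)
  have "length q \<le> sum_list q" if "\<forall>k\<in>set q. k \<ge> 1" for q :: "nat list"
    using that by (induction q) auto
  thus "length p \<le> n" using assms by (auto simp: partitions_def)
qed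

lemma hook_partition:
  assumes "1 \<le> l" "l \<le> n"
  shows "hook n l \<in> partitions n" "length (hook n l) = l"
proof -
  have "sorted_wrt (\<ge>) (replicate k (1::nat))" for k by (induction k) auto
  hence "sorted_wrt (\<ge>) (hook n l)" by (simp add: hook_def)
  moreover have "sum_list (hook n l) = n" using assms by (simp add: hook_def sum_list_replicate)
  ultimately show "hook n l \<in> partitions n" by (simp add: partitions_def) (simp add: hook_def)
  show "length (hook n l) = l" using assms by (simp add: hook_def)
qed

lemma spine_condition_hook: "2 \<le> l \<Longrightarrow> \<not> spine_condition n (hook n l)"
  by (simp add: spine_condition_def hook_def)

lemma hook_if_not_spine_condition:
  assumes p: "p \<in> partitions n" and n: "n \<ge> 1" and not: "\<not> spine_condition n p"
  shows "p = hook n (length p)"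
proof -
  obtain x xs where p_eq: "p = x # xs" using partition_length(1)[OF p n] by (cases p) auto
  have "y = 1" if y: "y \<in> set xs" for y
  proof -
    obtain z zs where xs: "xs = z # zs" using y by (cases xs) auto
    have "z \<le> 1" using not p_eq xs by (auto simp: spine_condition_def)
    moreover have "y \<le> z" using p y p_eq xs by (auto simp: partitions_def)
    moreover have "y \<ge> 1" using p y p_eq by (auto simp: partitions_def)
    ultimately show ?thesis by simp
  qed
  hence xs: "replicate (length xs) 1 = xs" by (intro replicate_length_same) blast
  have "sum_list (replicate k (1::nat)) = k" for k by (simp add: sum_list_replicate)
  from this[of "length xs"] have "sum_list xs = length xs" by (simp only: xs)
  moreover have "x + sum_list xs = n" using partitions_sum[OF p] by (simp only: p_eq sum_list.Cons)
  ultimately have "x = n - length p + 1" using partition_length(2)[OF p n] by (simp add: p_eq)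
  thus ?thesis unfolding hook_def using xs by (simp add: p_eq)
qed

lemma star_diff_hook:
  assumes "p = hook (sum_list p) (length p)"
  shows "star_diff p = 0"
  by (simp only: star_diff_def diff_self flip: assms)

lemma caterpillar_in_tree_space:
  assumes p: "p \<in> partitions n" and n: "n \<ge> 1"
  shows "chromatic_sym (caterpillar (tl p @ [hd p])) \<in> tree_space n"
proof -
  let ?\<alpha> = "tl p @ [hd p]"
  have "p \<noteq> []" using partition_length(1)[OF p n] by auto
  hence set: "set ?\<alpha> = set p" and sum: "sum_list ?\<alpha> = sum_list p" by (cases p; simp)+
  have pos: "\<forall>k\<in>set ?\<alpha>. k \<ge> 1" and ne: "?\<alpha> \<noteq> []" using p set by (simp_all add: partitions_def)
  note F = caterpillar_forest[OF pos ne]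
  have card: "card (cells ?\<alpha>) = n" using sum p by (simp only: card_cells partitions_sum)
  show "chromatic_sym (caterpillar ?\<alpha>) \<in> tree_space n"
    using chromatic_sym_in_tree_space[OF F] unfolding caterpillar_eq[OF pos] card .
qed

lemma star_in_caterpillar_basis:
  assumes "n \<ge> 1"
  shows "star_chrom [n] \<in> caterpillar_basis n"
proof -
  have pos: "\<forall>k\<in>set [n]. k \<ge> 1" using assms by simp
  have "spine_next (length [n]) = (\<lambda>i. i)" by (auto simp: spine_next_def)
  hence "caterpillar [n] = star_forest [n]" by (simp add: caterpillar_eq[OF pos] star_forest_eq)
  moreover have "[n] \<in> {p \<in> partitions n. spine_condition n p}"
    using assms by (simp add: partitions_def spine_condition_def)
  ultimately show ?thesis unfolding caterpillar_basis_eq by (metis (mono_tags, lifting) append_Nil image_eqI list.sel(1,3))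
qed

text \<open>Induction on length and then on the number of parts at least \<open>2\<close>, the order behind \<open>below\<close>.\<close>

lemma star_diff_in_span_basis:
  assumes n: "n \<ge> 1" and "p \<in> partitions n"
  shows "star_diff p \<in> ps.span (caterpillar_basis n)"
  using assms(2)
proof (induction p rule: wf_induct_rule[OF wf_measures[of "[length, big_parts]"]])
  case (1 p)
  note p = \<open>p \<in> partitions n\<close>
  show ?case
  proof (cases "p = hook n (length p)")
    case True
    hence "star_diff p = 0" by (intro star_diff_hook) (simp only: partitions_sum[OF p])
    thus ?thesis by (simp only: ps.span_zero)
  next
    case False
    hence "spine_condition n p" using hook_if_not_spine_condition[OF p n] by blast
    moreover have "p \<noteq> [n]" using False hook_1[OF n] by auto
    ultimately have p1: "length p \<ge> 2" "p ! 1 \<ge> 2" by (simp_all add: spine_condition_def)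
    show ?thesis
    proof (rule star_diff_from_caterpillar[OF p p1])
      show "star_diffs n (below (length p) (big_parts p)) \<subseteq> ps.span (caterpillar_basis n)"
        using "1.IH" by (fastforce simp: star_diffs_def below_def le_less)
      have "chromatic_sym (caterpillar (tl p @ [hd p])) \<in> caterpillar_basis n"
        using p \<open>spine_condition n p\<close> by (auto simp: caterpillar_basis_eq)
      thus "chromatic_sym (caterpillar (tl p @ [hd p])) - star_chrom [n] \<in> ps.span (caterpillar_basis n)"
        by (intro ps.span_diff ps.span_base star_in_caterpillar_basis n)
    qed
  qed
qed

text \<open>The common value of the three spaces in question.\<close>

abbreviation diff_space :: "nat \<Rightarrow> power_series set" where
  "diff_space n \<equiv> ps.span (insert (star_chrom [n]) (star_diffs n (\<lambda>_. True)))"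

lemma spaces_eq:
  assumes n: "n \<ge> 1"
  shows "tree_space n = diff_space n" and "ps.span (caterpillar_basis n) = tree_space n"
proof -
  have 1: "tree_space n \<subseteq> diff_space n"
    unfolding tree_space_def
  proof (intro ps.span_minimal ps.subspace_span subsetI)
    fix x assume "x \<in> {chromatic_sym T | T :: nat graph. tree_graph T \<and> card (verts T) = n}"
    then obtain T :: "nat graph" where T: "x = chromatic_sym T" "tree_graph T" "card (verts T) = n" by blast
    have "x - star_chrom [n] \<in> diff_space n"
      using tree_diff_in_span[OF T(2,3) n] ps.span_mono[OF subset_insertI] unfolding T(1) by blast
    hence "(x - star_chrom [n]) + star_chrom [n] \<in> diff_space n"
      by (intro ps.span_add) (auto intro: ps.span_base)
    thus "x \<in> diff_space n" by simp
  qed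
  have 2: "diff_space n \<subseteq> ps.span (caterpillar_basis n)"
    using star_diff_in_span_basis[OF n] star_in_caterpillar_basis[OF n]
    by (intro ps.span_minimal ps.subspace_span) (auto simp: star_diffs_def intro: ps.span_base)
  have 3: "ps.span (caterpillar_basis n) \<subseteq> tree_space n"
  proof (rule ps.span_minimal)
    show "caterpillar_basis n \<subseteq> tree_space n"
      using caterpillar_in_tree_space[OF _ n] by (auto simp: caterpillar_basis_eq)
    show "ps.subspace (tree_space n)" unfolding tree_space_def by (rule ps.subspace_span)
  qed
  show "tree_space n = diff_space n" "ps.span (caterpillar_basis n) = tree_space n"
    using 1 2 3 by blast+
qed

definition star_combinations :: "nat \<Rightarrow> power_series set" where
  "star_combinations n = {\<Sum>p\<in>partitions n. ps_scale (a p) (star_chrom p) | a :: nat list \<Rightarrow> rat.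
        \<forall>l\<in>{2..n}. (\<Sum>p\<in>{p \<in> partitions n. length p = l}. a p) = 0}"

lemma subspace_star_combinations: "ps.subspace (star_combinations n)"
proof (rule ps.subspaceI)
  show "0 \<in> star_combinations n"
    unfolding star_combinations_def by (intro CollectI exI[of _ "\<lambda>_. 0"]) (simp del: zero_fun_def)
next
  fix x y assume "x \<in> star_combinations n" "y \<in> star_combinations n"
  then obtain a b where "x = (\<Sum>p\<in>partitions n. ps_scale (a p) (star_chrom p))"
    "y = (\<Sum>p\<in>partitions n. ps_scale (b p) (star_chrom p))"
    "\<forall>l\<in>{2..n}. (\<Sum>p\<in>{p \<in> partitions n. length p = l}. a p) = 0"
    "\<forall>l\<in>{2..n}. (\<Sum>p\<in>{p \<in> partitions n. length p = l}. b p) = 0"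
    unfolding star_combinations_def by blast
  thus "x + y \<in> star_combinations n"
    unfolding star_combinations_def
    by (intro CollectI exI[of _ "\<lambda>p. a p + b p"]) (simp only: ps.scale_left_distrib sum.distrib, simp)
next
  fix c x assume "x \<in> star_combinations n"
  then obtain a where "x = (\<Sum>p\<in>partitions n. ps_scale (a p) (star_chrom p))"
    "\<forall>l\<in>{2..n}. (\<Sum>p\<in>{p \<in> partitions n. length p = l}. a p) = 0"
    unfolding star_combinations_def by blast
  thus "ps_scale c x \<in> star_combinations n"
    unfolding star_combinations_def
    by (intro CollectI exI[of _ "\<lambda>p. c * a p"])
       (simp add: ps.scale_sum_right flip: sum_distrib_left)
qed

text \<open>Replacing every star forest of length \<open>l\<close> by its difference to the hook of length \<open>l\<close> leaves over this
  hook with the sum of all coefficients of length \<open>l\<close> as its coefficient, which is zero unless \<open>l = 1\<close>.\<close>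

lemma star_combinations_eq:
  assumes n: "n \<ge> 1"
  shows "star_combinations n = diff_space n"
proof
  have unit: "(\<Sum>q\<in>partitions n. ps_scale (of_bool (q = p)) (star_chrom q)) = star_chrom p"
    if "p \<in> partitions n" for p
  proof -
    have "(\<Sum>q\<in>partitions n. ps_scale (of_bool (q = p)) (star_chrom q)) =
      (\<Sum>q\<in>{p}. ps_scale (of_bool (q = p)) (star_chrom q))"
      by (rule sum.mono_neutral_right) (use that finite_partitions in \<open>auto simp: ps_scale_def fun_eq_iff\<close>)
    thus ?thesis by (simp add: ps_scale_def)
  qed
  have count: "(\<Sum>q\<in>{q \<in> partitions n. length q = l}. of_bool (q = p)) = (of_bool (length p = l) :: rat)"
    if "p \<in> partitions n" for p l
    using that finite_partitions by (simp add: of_bool_def sum.delta)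
  show "diff_space n \<subseteq> star_combinations n"
  proof (rule ps.span_minimal[OF _ subspace_star_combinations], rule insert_subsetI)
    have "[n] \<in> partitions n" using n by (simp add: partitions_def)
    thus "star_chrom [n] \<in> star_combinations n" unfolding star_combinations_def
      by (intro CollectI exI[of _ "\<lambda>q. of_bool (q = [n])"]) (simp only: unit count, simp)
    show "star_diffs n (\<lambda>_. True) \<subseteq> star_combinations n"
    proof
      fix x assume "x \<in> star_diffs n (\<lambda>_. True)"
      then obtain p where p: "p \<in> partitions n" "x = star_diff p" by (auto simp: star_diffs_def)
      let ?h = "hook n (length p)"
      note h = hook_partition[OF partition_length[OF p(1) n]]
      have "x = star_chrom p - star_chrom ?h" using p by (simp only: star_diff_def partitions_sum)
      also have "\<dots> = (\<Sum>q\<in>partitions n. ps_scale (of_bool (q = p) - of_bool (q = ?h)) (star_chrom q))"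
        by (simp only: ps.scale_left_diff_distrib sum_subtractf unit p(1) h(1))
      finally show "x \<in> star_combinations n"
        unfolding star_combinations_def
        by (intro CollectI exI[of _ "\<lambda>q. of_bool (q = p) - of_bool (q = ?h)"])
           (simp only: sum_subtractf count p(1) h, simp)
    qed
  qed
  show "star_combinations n \<subseteq> diff_space n"
  proof
    fix x assume "x \<in> star_combinations n"
    then obtain a where x: "x = (\<Sum>p\<in>partitions n. ps_scale (a p) (star_chrom p))"
      and a: "\<And>l. l \<in> {2..n} \<Longrightarrow> (\<Sum>p\<in>{p \<in> partitions n. length p = l}. a p) = 0"
      unfolding star_combinations_def by blast
    have "star_chrom p = star_diff p + star_chrom (hook n (length p))" if "p \<in> partitions n" for p
      using that by (simp add: star_diff_def partitions_sum)
    hence "x = (\<Sum>p\<in>partitions n. ps_scale (a p) (star_diff p))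
        + (\<Sum>p\<in>partitions n. ps_scale (a p) (star_chrom (hook n (length p))))"
      by (simp only: x ps.scale_right_distrib flip: sum.distrib cong: sum.cong)
    moreover have "(\<Sum>p\<in>partitions n. ps_scale (a p) (star_diff p)) \<in> diff_space n"
      by (intro ps.span_sum ps.span_scale ps.span_base) (simp add: star_diffs_def)
    moreover have "(\<Sum>p\<in>partitions n. ps_scale (a p) (star_chrom (hook n (length p)))) \<in> diff_space n"
    proof -
      have "(\<Sum>p\<in>partitions n. ps_scale (a p) (star_chrom (hook n (length p)))) =
        (\<Sum>l\<in>{1..n}. \<Sum>p\<in>{p \<in> partitions n. length p = l}. ps_scale (a p) (star_chrom (hook n (length p))))"
        by (rule sum.group[symmetric])
           (use partition_length[OF _ n] in \<open>auto simp: finite_partitions\<close>)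
      also have "\<dots> = (\<Sum>l\<in>{1..n}. ps_scale (\<Sum>p\<in>{p \<in> partitions n. length p = l}. a p) (star_chrom (hook n l)))"
        by (intro sum.cong refl) (simp add: ps.scale_sum_left)
      finally have eq: "(\<Sum>p\<in>partitions n. ps_scale (a p) (star_chrom (hook n (length p)))) =
        (\<Sum>l\<in>{1..n}. ps_scale (\<Sum>p\<in>{p \<in> partitions n. length p = l}. a p) (star_chrom (hook n l)))" .
      show ?thesis unfolding eq
      proof (rule ps.span_sum)
        fix l assume l: "l \<in> {1..n}"
        show "ps_scale (\<Sum>p\<in>{p \<in> partitions n. length p = l}. a p) (star_chrom (hook n l)) \<in> diff_space n"
        proof (cases "l = 1")
          case True
          show ?thesis unfolding True hook_1[OF n] by (intro ps.span_scale ps.span_base) simp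
        next
          case False
          hence "(\<Sum>p\<in>{p \<in> partitions n. length p = l}. a p) = 0" using l by (intro a) auto
          thus ?thesis by (simp only: ps.scale_zero_left ps.span_zero)
        qed
      qed
    qed
    ultimately show "x \<in> diff_space n" by (simp only: ps.span_add)
  qed
qed

text \<open>The series of the star forests of the partitions that index no caterpillar complete the basis to a
  spanning set of all star forests. Its size is at most the number of partitions, which is the number of
  independent power sums it has to span; so no element of it is redundant.\<close>

lemma independent_caterpillar_basis:
  assumes n: "n \<ge> 1"
  shows "ps.independent (caterpillar_basis n)"
proof -
  define H where "H = star_chrom ` {p \<in> partitions n. \<not> spine_condition n p}"
  let ?S = "caterpillar_basis n \<union> H"
  have fin: "finite ?S" by (simp add: caterpillar_basis_eq H_def finite_partitions)
  \<comment> \<open>At most one series for every partition: its caterpillar, or its star forest if it is a hook.\<close>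
  have card: "card ?S \<le> card (partitions n)"
  proof -
    have "card ?S \<le> card (caterpillar_basis n) + card H" by (rule card_Un_le)
    also have "\<dots> \<le> card {p \<in> partitions n. spine_condition n p} + card {p \<in> partitions n. \<not> spine_condition n p}"
      unfolding caterpillar_basis_eq H_def by (intro add_mono card_image_le) (simp_all add: finite_partitions)
    also have "\<dots> = card (partitions n)"
      using finite_partitions by (subst card_Un_disjoint[symmetric]) (auto intro: arg_cong[where f = card])
    finally show ?thesis .
  qed
  have "star_chrom p \<in> ps.span ?S" if p: "p \<in> partitions n" for p
  proof -
    have "star_chrom (hook n (length p)) \<in> ?S"
    proof (cases "length p = 1")
      case True
      thus ?thesis using star_in_caterpillar_basis[OF n] hook_1[OF n] by simp
    next
      case False
      hence "2 \<le> length p" using partition_length(1)[OF p n] by simp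
      hence "hook n (length p) \<in> {p \<in> partitions n. \<not> spine_condition n p}"
        using hook_partition(1)[OF partition_length[OF p n]] spine_condition_hook by simp
      thus ?thesis unfolding H_def by blast
    qed
    moreover have "star_diff p \<in> ps.span ?S"
      using star_diff_in_span_basis[OF n p] ps.span_mono[of "caterpillar_basis n" ?S] by blast
    ultimately have "star_diff p + star_chrom (hook n (length p)) \<in> ps.span ?S"
      by (intro ps.span_add) (simp_all add: ps.span_base)
    thus ?thesis using p by (simp add: star_diff_def partitions_sum)
  qed
  hence "ps.span (star_chrom ` partitions n) \<subseteq> ps.span ?S"
    by (intro ps.span_minimal ps.subspace_span) auto
  moreover have "power_sum p \<in> ps.span (star_chrom ` partitions n)" if "p \<in> partitions n" for p
    using power_sum_in_span[of p] unfolding partitions_sum[OF that] .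
  ultimately have power: "power_sum ` partitions n \<subseteq> ps.span ?S" by blast
  have "ps.independent ?S"
  proof
    assume "ps.dependent ?S"
    then obtain x where x: "x \<in> ?S" "x \<in> ps.span (?S - {x})" unfolding ps.dependent_def by blast
    have "ps.span ?S \<subseteq> ps.span (?S - {x})"
      using x by (intro ps.span_minimal ps.subspace_span) (auto intro: ps.span_base)
    hence "power_sum ` partitions n \<subseteq> ps.span (?S - {x})" using power by blast
    moreover have "finite (?S - {x})" using fin by (rule finite_Diff)
    ultimately have "card (power_sum ` partitions n) \<le> card (?S - {x})"
      by (intro ps.independent_span_bound[OF _ power_sums_independent(2), THEN conjunct2])
    also have "\<dots> < card ?S" using fin x(1) by (intro psubset_card_mono) auto
    finally show False using card card_image[OF power_sums_independent(1)] by simp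
  qed
  thus ?thesis by (rule ps.independent_mono) simp
qed

theorem corollary4p13:
  fixes n :: nat
  assumes "n \<ge> 1"
  shows "tree_space n =
      {\<Sum>p\<in>partitions n. ps_scale (a p) (chromatic_sym (star_forest p)) | a :: nat list \<Rightarrow> rat.
        \<forall>l\<in>{2..n}. (\<Sum>p\<in>{p \<in> partitions n. length p = l}. a p) = 0}
    \<and> ps.independent (caterpillar_basis n)
    \<and> ps.span (caterpillar_basis n) = tree_space n"
  using spaces_eq[OF assms] star_combinations_eq[OF assms] independent_caterpillar_basis[OF assms]
  unfolding star_combinations_def by simp

end
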